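(* Let $(X,\rho,\mu)$ be a coarse median space of finite rank such that the metric space $(X,\rho)$ is uniformly locally finite, discrete, quasigeodesic, and of at most exponential growth. Then $(X,\rho)$ has Property A.
   Context: **Median algebras.** A median algebra is a set $\Phi$ with a ternary operation $\mu:\Phi^3\to\Phi$ such that for all $a,b,c,d,e\in\Phi$: (M1) $\mu(a,b,c)=\mu(b,c,a)=\mu(b,a,c)$; (M2) $\mu(a,a,b)=a$; (M3) $\mu(a,b,\mu(c,d,e))=\mu(\mu(a,b,c),\mu(a,b,d),e)$. The interval between $a,b\in\Phi$ is $[a,b]=\{c\in\Phi\mid\mu(a,b,c)=c\}$; a subset $C\subset\Phi$ is convex if $[a,b]\subset C$ for all $a,b\in C$. A wall is a partition of $\Phi$ into two non-empty convex subsets $\{H^-,H^+\}$ (half-spaces). Two walls cross if each of the four intersections of a half-space of the first with a half-space of the second is non-empty. $\Phi$ has rank at most $d$ if there is no collection of $d+1$ pairwise crossing walls of $\Phi$. **Coarse median spaces.** Let $(X,\rho)$ be a metric space and $\mu:X^3\to X$ a ternary operation. $(X,\rho,\mu)$ is a coarse median space if: (C1) there are constants $K\ge1$, $H(0)\ge0$ such that for all $a,b,c,a',b',c'\in X$: $\rho(\mu(a,b,c),\mu(a',b',c'))\le K(\rho(a,a')+\rho(b,b')+\rho(c,c'))+H(0)$; (C2) there is a function $H:\mathbb N\to[0,\infty)$ such that whenever $A\subseteq X$ with $1\le|A|\le p<\infty$, there is a finite median algebra $(\Pi,\mu_\Pi)$ and maps $\pi:A\to\Pi$, $\sigma:\Pi\to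 X$ such that $\rho(\sigma\mu_\Pi(x,y,z),\mu(\sigma x,\sigma y,\sigma z))\le H(p)$ for all $x,y,z\in\Pi$, and $\rho(a,\sigma\pi a)\le H(p)$ for all $a\in A$. The space has rank at most $d$ if (for some such parameters $K,H$) the median algebra $\Pi$ in (C2) can always be chosen of rank at most $d$; it has finite rank if it has rank at most $d$ for some $d\in\mathbb N$. **Metric conditions.** $B(x,R)$ denotes the closed ball. $X$ is uniformly locally finite if $\sup_{x\in X}|B(x,R)|<\infty$ for every $R>0$. $X$ has at most exponential growth if there are constants $c,c'\ge1$ with $|B(x,R)|\le c'c^{R}$ for all $x\in X$, $R\ge0$. $X$ is quasigeodesic if there are constants $G_1\ge 1,G_2\ge 0$ such that any two points $x,y\in X$ are joined by a $(G_1,G_2)$-quasigeodesic, i.e. a map $g:[0,T]\to X$ with $g(0)=x$, $g(T)=y$ and $\frac1{G_1}|s-t|-G_2\le\rho(g(s),g(t))\le G_1|s-t|+G_2$ for all $s,t\in[0,T]$. **Property A.** A uniformly locally finite discrete metric space $(X,\rho)$ has Property A if for all $R,\varepsilon>0$ there exists a map $\xi:X\to\ell^1(X)$ such that: $\|\xi(x)\|_1=1$ for all $x\in X$; $\|\xi(x)-\xi(y)\|_1\le\varepsilon$ for all $x,y\in X$ with $\rho(x,y)\le R$; and there exists $S>0$ such that for each $x\in X$, $\xi(x)$ is supported in $B(x,S)$. *)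

theory Defs
  imports "HOL-Analysis.Analysis"
begin

section \<open>Median algebras\<close>

locale median_algebra =
  fixes \<Phi> :: "'a set" and \<mu> :: "'a \<Rightarrow> 'a \<Rightarrow> 'a \<Rightarrow> 'a"
  assumes closed: "\<lbrakk>a \<in> \<Phi>; b \<in> \<Phi>; c \<in> \<Phi>\<rbrakk> \<Longrightarrow> \<mu> a b c \<in> \<Phi>"
    and M1_rotate: "\<lbrakk>a \<in> \<Phi>; b \<in> \<Phi>; c \<in> \<Phi>\<rbrakk> \<Longrightarrow> \<mu> a b c = \<mu> b c a"
    and M1_swap: "\<lbrakk>a \<in> \<Phi>; b \<in> \<Phi>; c \<in> \<Phi>\<rbrakk> \<Longrightarrow> \<mu> a b c = \<mu> b a c"
    and M2: "\<lbrakk>a \<in> \<Phi>; b \<in> \<Phi>\<rbrakk> \<Longrightarrow> \<mu> a a b = a"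
    and M3: "\<lbrakk>a \<in> \<Phi>; b \<in> \<Phi>; c \<in> \<Phi>; d \<in> \<Phi>; e \<in> \<Phi>\<rbrakk>
      \<Longrightarrow> \<mu> a b (\<mu> c d e) = \<mu> (\<mu> a b c) (\<mu> a b d) e"

definition median_interval ::
    "'a set \<Rightarrow> ('a \<Rightarrow> 'a \<Rightarrow> 'a \<Rightarrow> 'a) \<Rightarrow> 'a \<Rightarrow> 'a \<Rightarrow> 'a set" where
  "median_interval \<Phi> \<mu> a b = {c \<in> \<Phi>. \<mu> a b c = c}"

definition median_convex ::
    "'a set \<Rightarrow> ('a \<Rightarrow> 'a \<Rightarrow> 'a \<Rightarrow> 'a) \<Rightarrow> 'a set \<Rightarrow> bool" where
  "median_convex \<Phi> \<mu> C \<longleftrightarrow> C \<subseteq> \<Phi> \<and> (\<forall>a\<in>C. \<forall>b\<in>C. median_interval \<Phi> \<mu> a b \<subseteq> C)"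

text \<open>A wall is the unordered pair of its two half-spaces (which are non-empty, as
  \<^const>\<open>partition_on\<close> excludes the empty set).\<close>

definition wall ::
    "'a set \<Rightarrow> ('a \<Rightarrow> 'a \<Rightarrow> 'a \<Rightarrow> 'a) \<Rightarrow> 'a set set \<Rightarrow> bool" where
  "wall \<Phi> \<mu> W \<longleftrightarrow> partition_on \<Phi> W \<and> card W = 2 \<and> (\<forall>H\<in>W. median_convex \<Phi> \<mu> H)"

definition walls_cross :: "'a set set \<Rightarrow> 'a set set \<Rightarrow> bool" where
  "walls_cross W W' \<longleftrightarrow> (\<forall>H\<in>W. \<forall>H'\<in>W'. H \<inter> H' \<noteq> {})"

definition median_rank_le ::
    "'a set \<Rightarrow> ('a \<Rightarrow> 'a \<Rightarrow> 'a \<Rightarrow> 'a) \<Rightarrow> nat \<Rightarrow> bool" where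
  "median_rank_le \<Phi> \<mu> d \<longleftrightarrow>
     \<not> (\<exists>\<W>. (\<forall>W\<in>\<W>. wall \<Phi> \<mu> W) \<and> card \<W> = d + 1 \<and> pairwise walls_cross \<W>)"


section \<open>Coarse median spaces\<close>

text \<open>As usual for metric notions in the library, a metric space is a subset \<open>X\<close> of a type of
  class \<^class>\<open>metric_space\<close>, with the induced metric.\<close>

definition coarse_median_C1 ::
    "'a::metric_space set \<Rightarrow> ('a \<Rightarrow> 'a \<Rightarrow> 'a \<Rightarrow> 'a) \<Rightarrow> real \<Rightarrow> real \<Rightarrow> bool" where
  "coarse_median_C1 X \<mu> K h \<longleftrightarrow>
     (\<forall>a\<in>X. \<forall>b\<in>X. \<forall>c\<in>X. \<forall>a'\<in>X. \<forall>b'\<in>X. \<forall>c'\<in>X.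
        dist (\<mu> a b c) (\<mu> a' b' c') \<le> K * (dist a a' + dist b b' + dist c c') + h)"

definition median_approximation ::
    "'a::metric_space set \<Rightarrow> ('a \<Rightarrow> 'a \<Rightarrow> 'a \<Rightarrow> 'a) \<Rightarrow> 'a set \<Rightarrow> real
      \<Rightarrow> 'b set \<Rightarrow> ('b \<Rightarrow> 'b \<Rightarrow> 'b \<Rightarrow> 'b) \<Rightarrow> bool" where
  "median_approximation X \<mu> A h P m \<longleftrightarrow>
     finite P \<and> median_algebra P m \<and>
     (\<exists>\<pi> \<in> A \<rightarrow> P. \<exists>\<sigma> \<in> P \<rightarrow> X.
        (\<forall>x\<in>P. \<forall>y\<in>P. \<forall>z\<in>P. dist (\<sigma> (m x y z)) (\<mu> (\<sigma> x) (\<sigma> y) (\<sigma> z)) \<le> h) \<and>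
        (\<forall>a\<in>A. dist a (\<sigma> (\<pi> a)) \<le> h))"

text \<open>Every finite median algebra is isomorphic to one whose carrier is a set of natural numbers,
  so the existential quantifier over \<open>P :: nat set\<close> below ranges over all finite median
  algebras.\<close>

definition coarse_median_space ::
    "'a::metric_space set \<Rightarrow> ('a \<Rightarrow> 'a \<Rightarrow> 'a \<Rightarrow> 'a) \<Rightarrow> bool" where
  "coarse_median_space X \<mu> \<longleftrightarrow>
     (\<forall>a\<in>X. \<forall>b\<in>X. \<forall>c\<in>X. \<mu> a b c \<in> X) \<and>
     (\<exists>K\<ge>1. \<exists>H :: nat \<Rightarrow> real. (\<forall>p. H p \<ge> 0) \<and>
        coarse_median_C1 X \<mu> K (H 0) \<and>
        (\<forall>p A. A \<subseteq> X \<and> finite A \<and> 1 \<le> card A \<and> card A \<le> p \<longrightarrow>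
           (\<exists>P :: nat set. \<exists>m. median_approximation X \<mu> A (H p) P m)))"

definition coarse_median_rank_le ::
    "'a::metric_space set \<Rightarrow> ('a \<Rightarrow> 'a \<Rightarrow> 'a \<Rightarrow> 'a) \<Rightarrow> nat \<Rightarrow> bool" where
  "coarse_median_rank_le X \<mu> d \<longleftrightarrow>
     (\<exists>K\<ge>1. \<exists>H :: nat \<Rightarrow> real. (\<forall>p. H p \<ge> 0) \<and>
        coarse_median_C1 X \<mu> K (H 0) \<and>
        (\<forall>p A. A \<subseteq> X \<and> finite A \<and> 1 \<le> card A \<and> card A \<le> p \<longrightarrow>
           (\<exists>P :: nat set. \<exists>m.
              median_approximation X \<mu> A (H p) P m \<and> median_rank_le P m d)))"

definition coarse_median_finite_rank ::
    "'a::metric_space set \<Rightarrow> ('a \<Rightarrow> 'a \<Rightarrow> 'a \<Rightarrow> 'a) \<Rightarrow> bool" where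
  "coarse_median_finite_rank X \<mu> \<longleftrightarrow> (\<exists>d. coarse_median_rank_le X \<mu> d)"


section \<open>Conditions on metric spaces\<close>

text \<open>The finiteness of balls is stated separately because \<^const>\<open>card\<close> is \<open>0\<close> on infinite
  sets.\<close>

definition uniformly_locally_finite :: "'a::metric_space set \<Rightarrow> bool" where
  "uniformly_locally_finite X \<longleftrightarrow>
     (\<forall>R>0. \<exists>N. \<forall>x\<in>X. finite (X \<inter> cball x R) \<and> card (X \<inter> cball x R) \<le> N)"

definition at_most_exponential_growth :: "'a::metric_space set \<Rightarrow> bool" where
  "at_most_exponential_growth X \<longleftrightarrow>
     (\<exists>c\<ge>1. \<exists>c'\<ge>1. \<forall>x\<in>X. \<forall>R\<ge>0.
        finite (X \<inter> cball x R) \<and> real (card (X \<inter> cball x R)) \<le> c' * c powr R)"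

definition quasigeodesic_path ::
    "'a::metric_space set \<Rightarrow> real \<Rightarrow> real \<Rightarrow> real \<Rightarrow> (real \<Rightarrow> 'a) \<Rightarrow> bool" where
  "quasigeodesic_path X G\<^sub>1 G\<^sub>2 T g \<longleftrightarrow>
     g \<in> {0..T} \<rightarrow> X \<and>
     (\<forall>s\<in>{0..T}. \<forall>t\<in>{0..T}.
        (1 / G\<^sub>1) * \<bar>s - t\<bar> - G\<^sub>2 \<le> dist (g s) (g t) \<and>
        dist (g s) (g t) \<le> G\<^sub>1 * \<bar>s - t\<bar> + G\<^sub>2)"

definition quasigeodesic_space :: "'a::metric_space set \<Rightarrow> bool" where
  "quasigeodesic_space X \<longleftrightarrow>
     (\<exists>G\<^sub>1\<ge>1. \<exists>G\<^sub>2\<ge>0. \<forall>x\<in>X. \<forall>y\<in>X.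
        \<exists>T\<ge>0. \<exists>g. quasigeodesic_path X G\<^sub>1 G\<^sub>2 T g \<and> g 0 = x \<and> g T = y)"


section \<open>Property A\<close>

text \<open>Elements of \<open>\<ell>\<^sup>1(X)\<close> are represented by functions on the ambient type, of which only
  the values on \<open>X\<close> are relevant. Scalars are real; replacing a complex-valued family by its
  pointwise absolute values shows that complex scalars give the same property.\<close>

definition ell1 :: "'a set \<Rightarrow> ('a \<Rightarrow> real) set" where
  "ell1 X = {f. (\<lambda>z. \<bar>f z\<bar>) summable_on X}"

definition ell1_norm :: "'a set \<Rightarrow> ('a \<Rightarrow> real) \<Rightarrow> real" where
  "ell1_norm X f = (\<Sum>\<^sub>\<infinity>z\<in>X. \<bar>f z\<bar>)"

definition property_A :: "'a::metric_space set \<Rightarrow> bool" where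
  "property_A X \<longleftrightarrow>
     (\<forall>R>0. \<forall>\<epsilon>>0. \<exists>\<xi> \<in> X \<rightarrow> ell1 X.
        (\<forall>x\<in>X. ell1_norm X (\<xi> x) = 1) \<and>
        (\<forall>x\<in>X. \<forall>y\<in>X. dist x y \<le> R \<longrightarrow> ell1_norm X (\<lambda>z. \<xi> x z - \<xi> y z) \<le> \<epsilon>) \<and>
        (\<exists>S>0. \<forall>x\<in>X. {z \<in> X. \<xi> x z \<noteq> 0} \<subseteq> cball x S))"

end

theory Submission
  imports Defs
begin

text \<open>
  Coarse intervals \<open>[y, b]\<close> are totally bounded at large scales: for every \<open>\<epsilon> > 0\<close> the part of
  \<open>[y, b]\<close> at distance at most \<open>r\<close> from \<open>y\<close> is covered by \<open>N(\<epsilon>)\<close> balls of radius \<open>\<epsilon> r\<close> once \<open>r\<close> is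
  large. To see this, approximate sufficiently many points by a finite median algebra of rank \<open>d\<close>;
  there the interval is a finite distributive lattice whose join-irreducible elements form a poset
  of width at most \<open>d\<close>, because incomparable ones define crossing walls. A chain of
  join-irreducible elements below the end of a path with \<open>M\<close> short steps is split into \<open>M\<close> parts
  according to the step at which the path passes above the element; cutting down the elements of
  one part to the beginning of the step moves them little and decreases the width, so that
  induction on the width applies.

  Joining the points of such a net gives for every \<open>y\<close> and every scale a point \<open>h y \<in> [y, b]\<close> at
  linear distance from \<open>y\<close> that lies coarsely above every point of \<open>[y, b]\<close> near \<open>y\<close>. If \<open>x\<close> is close
  to \<open>y\<close>, then \<open>\<mu>(x, y, b)\<close> is such a point, and therefore \<open>h y\<close> is close to \<open>[x, b]\<close>. By the covering
  property and the exponential growth bound, the set \<open>h (B(x, 2 l))\<close> has at most \<open>exp (\<alpha> l)\<close>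
  elements, for arbitrarily small \<open>\<alpha>\<close> and large \<open>l\<close>, and this yields Property A.
\<close>

section \<open>Covering numbers\<close>

text \<open>Peel off the minimal elements: they form an antichain, so each layer removes at most
  \<open>k\<close> elements. The least element of a chain found in the rest is not minimal in
  \<open>V\<close>, so the chain can be prolonged downwards.\<close>

lemma chain_if_antichains_small:
  fixes V :: "'b::order set"
  assumes "finite V"
    and "\<And>T. T \<subseteq> V \<Longrightarrow> (\<And>x y. x \<in> T \<Longrightarrow> y \<in> T \<Longrightarrow> x \<le> y \<Longrightarrow> x = y) \<Longrightarrow> card T \<le> k"
    and "k * n < card V"
  shows "\<exists>C\<subseteq>V. card C = Suc n \<and> (\<forall>x\<in>C. \<forall>y\<in>C. x \<le> y \<or> y \<le> x)"
  using assms
proof (induction n arbitrary: V)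
  case 0
  then obtain x where "x \<in> V" by (metis card_gt_0_iff ex_in_conv mult_0_right)
  then show ?case by (intro exI[of _ "{x}"]) auto
next
  case (Suc n)
  define T where "T = {x \<in> V. \<forall>y\<in>V. y \<le> x \<longrightarrow> y = x}"
  have T: "T \<subseteq> V" by (auto simp: T_def)
  have cardT: "card T \<le> k" by (rule Suc.prems(2)[OF T]) (auto simp: T_def)
  have "card (V - T) = card V - card T"
    by (meson T Suc.prems(1) card_Diff_subset finite_subset)
  then have "k * n < card (V - T)" using Suc.prems(3) cardT by simp
  then obtain C where C: "C \<subseteq> V - T" "card C = Suc n" "\<forall>x\<in>C. \<forall>y\<in>C. x \<le> y \<or> y \<le> x"
    using Suc.IH[of "V - T"] Suc.prems(1) Suc.prems(2)[OF subset_trans[OF _ Diff_subset]] by auto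
  have finC: "finite C" using C(2) card.infinite by fastforce
  then obtain x where x: "x \<in> C" "\<forall>y\<in>C. y \<le> x \<longrightarrow> x = y"
    using finite_has_minimal[of C] C(2) by fastforce
  then obtain y where y: "y \<in> V" "y \<le> x" "y \<noteq> x" using C(1) by (auto simp: T_def)
  have below: "y \<le> z" if "z \<in> C" for z
  proof -
    have "x \<le> z" using C(3) x that by metis
    then show ?thesis using y(2) by simp
  qed
  have "y \<notin> C" using x y by auto
  with finC C y below show ?case
    by (intro exI[of _ "insert y C"]) auto
qed

lemma pigeonhole_fibre:
  assumes "finite T" and "f ` T \<subseteq> {..<M}" and "M * n < card T"
  shows "\<exists>t<M. n < card {x \<in> T. f x = t}"
proof (rule ccontr)
  assume "\<not> ?thesis"
  then have *: "card {x \<in> T. f x = t} \<le> n" if "t < M" for t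
    using that by (meson leI)
  have "T = (\<Union>t<M. {x \<in> T. f x = t})" using assms(2) by auto
  then have "card T \<le> (\<Sum>t<M. card {x \<in> T. f x = t})"
    using card_UN_le[of "{..<M}" "\<lambda>t. {x \<in> T. f x = t}"] by simp
  also have "\<dots> \<le> (\<Sum>t<M. n)" using * by (intro sum_mono) auto
  finally show False using assms(3) by simp
qed

text \<open>A separated subset of largest cardinality is a net, since any point it fails to cover
  could be added to it.\<close>

lemma finite_net:
  assumes sep: "\<And>T. finite T \<Longrightarrow> T \<subseteq> Z \<Longrightarrow> (\<And>x y. x \<in> T \<Longrightarrow> y \<in> T \<Longrightarrow> x \<noteq> y \<Longrightarrow> \<delta> < D x y)
      \<Longrightarrow> card T \<le> n"
    and sym: "\<And>x y. x \<in> Z \<Longrightarrow> y \<in> Z \<Longrightarrow> D x y = D y x"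
    and self: "\<And>x. x \<in> Z \<Longrightarrow> D x x \<le> (\<delta>::real)"
  shows "\<exists>F\<subseteq>Z. finite F \<and> card F \<le> n \<and> (\<forall>z\<in>Z. \<exists>f\<in>F. D z f \<le> \<delta>)"
proof -
  define P where "P T \<longleftrightarrow> finite T \<and> T \<subseteq> Z \<and> (\<forall>x\<in>T. \<forall>y\<in>T. x \<noteq> y \<longrightarrow> \<delta> < D x y)" for T
  have bound: "card T \<le> n" if "P T" for T
    by (rule sep) (use that in \<open>auto simp: P_def\<close>)
  have "P {}" by (simp add: P_def)
  then obtain F where F: "P F" "\<And>T. P T \<Longrightarrow> card T \<le> card F"
    using ex_has_greatest_nat[of P "{}" card "Suc n"] bound by (metis less_Suc_eq_le)
  have "\<exists>f\<in>F. D z f \<le> \<delta>" if z: "z \<in> Z" for z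
  proof (rule ccontr)
    assume neg: "\<not> ?thesis"
    have "z \<notin> F" using neg self[OF z] by auto
    moreover have "P (insert z F)"
    proof -
      have "\<delta> < D z f \<and> \<delta> < D f z" if "f \<in> F" for f
        using neg that z sym[OF z, of f] F(1) by (fastforce simp: P_def not_le)
      then show ?thesis using F(1) z by (simp add: P_def)
    qed
    ultimately show False using F(2)[of "insert z F"] F(1) by (auto simp: P_def)
  qed
  then show ?thesis using F(1) bound[OF F(1)] by (auto simp: P_def)
qed

text \<open>Covering in terms of labels: \<open>g\<close> splits \<open>S\<close> into at most
  \<open>n\<close> pieces of \<open>D\<close>-diameter at most \<delta>. Pieces have no centres, so
  the notion passes to subsets, and labels of several sets can be combined.\<close>

definition coverable :: "('b \<Rightarrow> 'b \<Rightarrow> real) \<Rightarrow> 'b set \<Rightarrow> nat \<Rightarrow> real \<Rightarrow> bool" where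
  "coverable D S n \<delta> \<longleftrightarrow>
     (\<exists>g. g ` S \<subseteq> {..<n} \<and> (\<forall>x\<in>S. \<forall>y\<in>S. g x = (g y :: nat) \<longrightarrow> D x y \<le> \<delta>))"

lemma coverable_mono:
  assumes "coverable D S n \<delta>" and "S' \<subseteq> S" and "n \<le> n'" and "\<delta> \<le> \<delta>'"
  shows "coverable D S' n' \<delta>'"
proof -
  obtain g where g: "g ` S \<subseteq> {..<n}" "\<forall>x\<in>S. \<forall>y\<in>S. g x = g y \<longrightarrow> D x y \<le> \<delta>"
    using assms(1) by (auto simp: coverable_def)
  have "g ` S' \<subseteq> {..<n'}" using g(1) assms(2,3) by fastforce
  moreover have "\<forall>x\<in>S'. \<forall>y\<in>S'. g x = g y \<longrightarrow> D x y \<le> \<delta>'"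
    using g(2) assms(2,4) by fastforce
  ultimately show ?thesis by (auto simp: coverable_def)
qed

lemma coverable_pigeonhole:
  assumes "coverable D (f ` T) n \<delta>" and "finite T" and "n < card T"
  shows "\<exists>x\<in>T. \<exists>y\<in>T. x \<noteq> y \<and> D (f x) (f y) \<le> \<delta>"
proof -
  obtain g where g: "g ` f ` T \<subseteq> {..<n}" "\<forall>x\<in>f ` T. \<forall>y\<in>f ` T. g x = g y \<longrightarrow> D x y \<le> \<delta>"
    using assms(1) by (auto simp: coverable_def)
  have "card ((g \<circ> f) ` T) \<le> card {..<n}"
    using g(1) by (intro card_mono) (auto simp: image_comp)
  then have "\<not> inj_on (g \<circ> f) T"
    using assms(3) by (intro pigeonhole) simp
  then show ?thesis using g(2) by (auto simp: inj_on_def)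
qed

lemma coverable_image2:
  assumes A: "coverable D A n \<delta>" and B: "coverable D B m \<delta>'"
    and S: "\<And>x. x \<in> S \<Longrightarrow> \<exists>a\<in>A. \<exists>b\<in>B. x = f a b"
    and D: "\<And>a a' b b'. a \<in> A \<Longrightarrow> a' \<in> A \<Longrightarrow> b \<in> B \<Longrightarrow> b' \<in> B \<Longrightarrow> D a a' \<le> \<delta> \<Longrightarrow> D b b' \<le> \<delta>' \<Longrightarrow>
      D (f a b) (f a' b') \<le> \<delta>''"
  shows "coverable D S (n * m) \<delta>''"
proof -
  obtain g where g: "g ` A \<subseteq> {..<n}" "\<forall>x\<in>A. \<forall>y\<in>A. g x = g y \<longrightarrow> D x y \<le> \<delta>"
    using A by (auto simp: coverable_def)
  obtain h where h: "h ` B \<subseteq> {..<m}" "\<forall>x\<in>B. \<forall>y\<in>B. h x = h y \<longrightarrow> D x y \<le> \<delta>'"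
    using B by (auto simp: coverable_def)
  obtain a b where ab: "\<And>x. x \<in> S \<Longrightarrow> a x \<in> A \<and> b x \<in> B \<and> x = f (a x) (b x)"
    using S by metis
  \<comment> \<open>The two labels of \<open>x\<close> are written as one number in base
    \<open>m\<close> and recovered by \<open>div\<close> and \<open>mod\<close>.\<close>
  define k where "k x = g (a x) * m + h (b x)" for x
  have lt: "g (a x) < n" "h (b x) < m" if "x \<in> S" for x using ab[OF that] g(1) h(1) by auto
  have "k x < n * m" if "x \<in> S" for x
  proof -
    have "k x < (g (a x) + 1) * m" using lt[OF that] by (simp add: k_def algebra_simps)
    also have "\<dots> \<le> n * m" using lt[OF that] by (intro mult_right_mono) auto
    finally show ?thesis .
  qed
  moreover have "D x y \<le> \<delta>''" if "x \<in> S" "y \<in> S" "k x = k y" for x y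
  proof -
    have "k z div m = g (a z)" "k z mod m = h (b z)" if "z \<in> S" for z
      using lt[OF that] by (simp_all add: k_def)
    then have "g (a x) = g (a y)" "h (b x) = h (b y)" using that by metis+
    then show ?thesis using D[of "a x" "a y" "b x" "b y"] ab that g(2) h(2) by metis
  qed
  ultimately show ?thesis unfolding coverable_def by (intro exI[of _ k]) auto
qed

text \<open>Points are labelled by a centre of a \<delta>-net within distance \<delta>; a common
  centre gives distance at most \<open>2 * \<delta>\<close>.\<close>

lemma coverable_if_separated_small:
  assumes sep: "\<And>T. finite T \<Longrightarrow> T \<subseteq> Z \<Longrightarrow> (\<And>x y. x \<in> T \<Longrightarrow> y \<in> T \<Longrightarrow> x \<noteq> y \<Longrightarrow> \<delta> < D x y)
      \<Longrightarrow> card T \<le> n"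
    and sym: "\<And>x y. x \<in> Z \<Longrightarrow> y \<in> Z \<Longrightarrow> D x y = D y x"
    and self: "\<And>x. x \<in> Z \<Longrightarrow> D x x \<le> \<delta>"
    and tri: "\<And>x y z. x \<in> Z \<Longrightarrow> y \<in> Z \<Longrightarrow> z \<in> Z \<Longrightarrow> D x z \<le> D x y + D y z"
  shows "coverable D Z n (2 * \<delta>)"
proof -
  have "\<exists>F\<subseteq>Z. finite F \<and> card F \<le> n \<and> (\<forall>z\<in>Z. \<exists>f\<in>F. D z f \<le> \<delta>)"
    by (rule finite_net; (rule sep sym self)?; assumption?)
  then obtain F where F: "F \<subseteq> Z" "finite F" "card F \<le> n" "\<forall>z\<in>Z. \<exists>f\<in>F. D z f \<le> \<delta>"
    by auto
  obtain e :: "'a \<Rightarrow> nat" where e: "e ` F = {0..<card F}" "inj_on e F"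
    using ex_bij_betw_finite_nat[OF F(2)] by (auto simp: bij_betw_def)
  obtain c where c: "\<And>z. z \<in> Z \<Longrightarrow> c z \<in> F \<and> D z (c z) \<le> \<delta>" using F(4) by metis
  have "D x y \<le> 2 * \<delta>" if xy: "x \<in> Z" "y \<in> Z" "e (c x) = e (c y)" for x y
  proof -
    have "c x \<in> F" "c y \<in> F" using xy c by auto
    have "c x = c y" by (rule inj_onD[OF e(2) xy(3)]) fact+
    moreover have "c x \<in> Z" using \<open>c x \<in> F\<close> F(1) by auto
    ultimately have "D x y \<le> D x (c x) + D y (c x)"
      using tri[of x "c x" y] sym[of y "c x"] xy by simp
    then show ?thesis using c[OF xy(1)] c[OF xy(2)] \<open>c x = c y\<close> by simp
  qed
  moreover have "e (c z) < n" if "z \<in> Z" for z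
  proof -
    have "e (c z) \<in> e ` F" using c that by blast
    then show ?thesis using e F(3) by simp
  qed
  ultimately show ?thesis unfolding coverable_def by (intro exI[of _ "e \<circ> c"]) auto
qed

section \<open>Coarse lattices of bounded width\<close>

text \<open>Lengths in the covering argument are measured in units of \<open>s\<close>. If the
  generators are covered by pieces of diameter \<open>b\<close>, then joins of \<open>i\<close> of
  them are covered by pieces of this diameter: each further join costs the Lipschitz factor
  \<open>K\<close> and one unit.\<close>

fun join_radius :: "real \<Rightarrow> real \<Rightarrow> nat \<Rightarrow> real" where
  "join_radius K b 0 = 0"
| "join_radius K b (Suc i) = K * (join_radius K b i + b) + 1"

text \<open>Generators are compared after being cut down, which moves each by at most
  \<open>K\<^sup>2 + K + 1\<close> units and lowers the width to \<open>k\<close>. The outer factor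
  2 turns a separation bound into a diameter.\<close>

fun cover_radius :: "real \<Rightarrow> nat \<Rightarrow> real" where
  "cover_radius K 0 = 0"
| "cover_radius K (Suc k) = join_radius K (2 * (cover_radius K k + 2 * (K\<^sup>2 + K + 1))) (Suc k)"

text \<open>\<open>Suc k\<close> bounds antichains, \<open>M\<close> counts the steps of a path and
  \<open>cover_number M k\<close> the pieces of cut down generators; the product bounds a separated
  set of generators. One label is added for the base element, and a join has at most
  \<open>Suc k\<close> generators.\<close>

fun cover_number :: "nat \<Rightarrow> nat \<Rightarrow> nat" where
  "cover_number M 0 = 1"
| "cover_number M (Suc k) = Suc (Suc k * (M * cover_number M k)) ^ Suc k"

lemma join_radius_nonneg: "0 \<le> K \<Longrightarrow> 0 \<le> b \<Longrightarrow> 0 \<le> join_radius K b i"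
  by (induction i) auto

lemma join_radius_mono: "1 \<le> K \<Longrightarrow> 0 \<le> b \<Longrightarrow> i \<le> j \<Longrightarrow> join_radius K b i \<le> join_radius K b j"
proof (induction j)
  case (Suc n)
  have nn: "0 \<le> join_radius K b n" using Suc by (intro join_radius_nonneg) auto
  have "1 * (join_radius K b n + b) \<le> K * (join_radius K b n + b)"
    using Suc nn by (intro mult_right_mono) auto
  then show ?case using Suc by (auto simp: le_Suc_eq)
qed simp

lemma cover_radius_nonneg: "0 \<le> K \<Longrightarrow> 0 \<le> cover_radius K k"
proof (induction k)
  case (Suc k)
  then show ?case unfolding cover_radius.simps by (intro join_radius_nonneg) auto
qed simp

text \<open>A finite distributive lattice, given as a family of sets of join-irreducible elements with
  \<open>pr j\<close> the principal ideal of \<open>j\<close>. The function \<open>D\<close> need not be definite: it is the pull-back of a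
  metric along an approximating map.\<close>

locale coarse_set_lattice =
  fixes L :: "'w set set" and pr :: "'w \<Rightarrow> 'w set" and D :: "'w set \<Rightarrow> 'w set \<Rightarrow> real"
    and K s :: real
  assumes finite_mem: "A \<in> L \<Longrightarrow> finite A"
    and Un_mem: "A \<in> L \<Longrightarrow> B \<in> L \<Longrightarrow> A \<union> B \<in> L"
    and Int_mem: "A \<in> L \<Longrightarrow> B \<in> L \<Longrightarrow> A \<inter> B \<in> L"
    and pr_mem: "j \<in> \<Union>L \<Longrightarrow> pr j \<in> L"
    and in_pr: "j \<in> \<Union>L \<Longrightarrow> j \<in> pr j"
    and pr_subset: "A \<in> L \<Longrightarrow> j \<in> A \<Longrightarrow> pr j \<subseteq> A"
    and pr_inj: "inj_on pr (\<Union>L)"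
    and D_self: "A \<in> L \<Longrightarrow> D A A = 0"
    and D_sym: "A \<in> L \<Longrightarrow> B \<in> L \<Longrightarrow> D A B = D B A"
    and D_tri: "A \<in> L \<Longrightarrow> B \<in> L \<Longrightarrow> C \<in> L \<Longrightarrow> D A C \<le> D A B + D B C"
    and D_Un: "A \<in> L \<Longrightarrow> A' \<in> L \<Longrightarrow> B \<in> L \<Longrightarrow> B' \<in> L
      \<Longrightarrow> D (A \<union> B) (A' \<union> B') \<le> K * (D A A' + D B B') + s"
    and D_Int: "A \<in> L \<Longrightarrow> A' \<in> L \<Longrightarrow> B \<in> L \<Longrightarrow> B' \<in> L
      \<Longrightarrow> D (A \<inter> B) (A' \<inter> B') \<le> K * (D A A' + D B B') + s"
    and K_nonneg: "0 \<le> K" and s_nonneg: "0 \<le> s"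
begin

section \<open>Antichains, paths and joins in a coarse lattice\<close>

definition antichain :: "'w set \<Rightarrow> bool" where
  "antichain T \<longleftrightarrow> (\<forall>i\<in>T. \<forall>j\<in>T. i \<noteq> j \<longrightarrow> \<not> pr i \<subseteq> pr j)"

definition width_le :: "nat \<Rightarrow> 'w set \<Rightarrow> bool" where
  "width_le k V \<longleftrightarrow> (\<forall>T\<subseteq>V. finite T \<longrightarrow> antichain T \<longrightarrow> card T \<le> k)"

text \<open>The path starts at the bottom of the lattice. Its step length is the additive error
  \<open>s\<close> itself, so that all estimates become multiples of \<open>s\<close>.\<close>

definition step_path :: "nat \<Rightarrow> (nat \<Rightarrow> 'w set) \<Rightarrow> bool" where
  "step_path M a \<longleftrightarrow> (\<forall>t\<le>M. a t \<in> L) \<and> a 0 = {} \<and> (\<forall>t<M. D (a t) (a (Suc t)) \<le> s)"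

definition joins :: "'w set \<Rightarrow> 'w set \<Rightarrow> nat \<Rightarrow> 'w set set" where
  "joins u V i = {u \<union> \<Union>(pr ` B) | B. B \<subseteq> V \<and> finite B \<and> card B \<le> i}"

lemma joins_subset:
  assumes "u \<in> L" and "V \<subseteq> \<Union>L"
  shows "joins u V i \<subseteq> L"
proof -
  have "u \<union> \<Union>(pr ` B) \<in> L" if "finite B" "B \<subseteq> V" for B
    using that
  proof (induction B rule: finite_induct)
    case (insert j B)
    have "u \<union> \<Union>(pr ` insert j B) = pr j \<union> (u \<union> \<Union>(pr ` B))" by auto
    moreover have "pr j \<in> L" using insert assms by (intro pr_mem) auto
    ultimately show ?case using insert Un_mem by simp
  qed (simp add: assms)
  then show ?thesis by (auto simp: joins_def)
qed

text \<open>A nonempty join of at most \<open>Suc i\<close> generators is one of at most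
  \<open>i\<close> generators united with one more, so labels multiply and \<open>D_Un\<close>
  controls the new diameter.\<close>

lemma coverable_joins:
  assumes u: "u \<in> L" and V: "V \<subseteq> \<Union>L" and Z: "coverable D ((\<lambda>j. u \<union> pr j) ` V) n (b * s)"
    and b: "0 \<le> b"
  shows "coverable D (joins u V i) (Suc n ^ i) (join_radius K b i * s)"
proof (induction i)
  case 0
  have "joins u V 0 = {u}" by (auto simp: joins_def)
  then show ?case using D_self[OF u] by (auto simp: coverable_def)
next
  case (Suc i)
  \<comment> \<open>The base \<open>u\<close> joins the generators, with its own label
    \<open>n\<close>, to take care of the empty join.\<close>
  let ?Z = "insert u ((\<lambda>j. u \<union> pr j) ` V)"
  have ZL: "?Z \<subseteq> L" using u V pr_mem Un_mem by auto
  have Z': "coverable D ?Z (Suc n) (b * s)"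
  proof -
    obtain g where g: "g ` (\<lambda>j. u \<union> pr j) ` V \<subseteq> {..<n}"
      "\<forall>x\<in>(\<lambda>j. u \<union> pr j) ` V. \<forall>y\<in>(\<lambda>j. u \<union> pr j) ` V. g x = g y \<longrightarrow> D x y \<le> b * s"
      using Z by (auto simp: coverable_def)
    have less: "g z < n" if "z \<in> (\<lambda>j. u \<union> pr j) ` V" for z using g(1) that by blast
    show ?thesis unfolding coverable_def
    proof (intro exI[of _ "\<lambda>x. if x \<in> (\<lambda>j. u \<union> pr j) ` V then g x else n"] conjI ballI impI)
      show "(\<lambda>x. if x \<in> (\<lambda>j. u \<union> pr j) ` V then g x else n) ` ?Z \<subseteq> {..<Suc n}"
        using less by (auto simp: less_Suc_eq)
    next
      fix x y assume xy: "x \<in> ?Z" "y \<in> ?Z" and eq: "(if x \<in> (\<lambda>j. u \<union> pr j) ` V then g x else n)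
        = (if y \<in> (\<lambda>j. u \<union> pr j) ` V then g y else n)"
      consider "x \<in> (\<lambda>j. u \<union> pr j) ` V" "y \<in> (\<lambda>j. u \<union> pr j) ` V" | "x = u" "y = u"
        using xy eq less[of x] less[of y] by (auto split: if_splits)
      then show "D x y \<le> b * s"
      proof cases
        case 1
        then show ?thesis using g(2) eq by metis
      next
        case 2
        then show ?thesis using D_self[OF u] b s_nonneg by simp
      qed
    qed
  qed
  have "coverable D (joins u V (Suc i)) (Suc n ^ i * Suc n) (join_radius K b (Suc i) * s)"
  proof (rule coverable_image2[OF Suc Z'])
    fix x assume "x \<in> joins u V (Suc i)"
    then obtain B where B: "x = u \<union> \<Union>(pr ` B)" "B \<subseteq> V" "finite B" "card B \<le> Suc i"
      by (auto simp: joins_def)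
    show "\<exists>a\<in>joins u V i. \<exists>z\<in>?Z. x = a \<union> z"
    proof (cases "B = {}")
      case True
      then have "x = u" "u \<in> joins u V i" using B by (auto simp: joins_def intro: exI[of _ "{}"])
      then show ?thesis by (intro bexI[of _ u]) auto
    next
      case False
      then obtain j where j: "j \<in> B" by auto
      have "B - {j} \<subseteq> V" "finite (B - {j})" "card (B - {j}) \<le> i" using B j by auto
      then have "u \<union> \<Union>(pr ` (B - {j})) \<in> joins u V i" unfolding joins_def by blast
      moreover have "x = (u \<union> \<Union>(pr ` (B - {j}))) \<union> (u \<union> pr j)" using B j by auto
      moreover have "u \<union> pr j \<in> ?Z" using B j by auto
      ultimately show ?thesis by blast
    qed
  next
    fix a a' z z'
    assume a: "a \<in> joins u V i" "a' \<in> joins u V i" and z: "z \<in> ?Z" "z' \<in> ?Z"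
      and d: "D a a' \<le> join_radius K b i * s" "D z z' \<le> b * s"
    have "D (a \<union> z) (a' \<union> z') \<le> K * (D a a' + D z z') + s"
      using a z ZL joins_subset[OF u V] by (intro D_Un) auto
    also have "\<dots> \<le> K * (join_radius K b i * s + b * s) + s"
      using d K_nonneg by (intro add_mono mult_left_mono) auto
    finally show "D (a \<union> z) (a' \<union> z') \<le> join_radius K b (Suc i) * s"
      by (simp add: algebra_simps)
  qed
  then show ?case by (simp add: mult.commute)
qed

lemma chain_top:
  assumes "finite C" and "C \<noteq> {}" and "\<forall>i\<in>C. \<forall>j\<in>C. pr i \<subseteq> pr j \<or> pr j \<subseteq> pr i"
  shows "\<exists>j\<in>C. \<forall>i\<in>C. pr i \<subseteq> pr j"
proof -
  obtain j where j: "j \<in> C" "\<forall>i\<in>C. pr j \<subseteq> pr i \<longrightarrow> pr j = pr i"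
    using finite_has_maximal[of "pr ` C"] assms(1,2) by auto
  then have "\<forall>i\<in>C. pr i \<subseteq> pr j" using assms(3) by auto
  then show ?thesis using j(1) by auto
qed

lemma chain_bot:
  assumes "finite C" and "C \<noteq> {}" and "\<forall>i\<in>C. \<forall>j\<in>C. pr i \<subseteq> pr j \<or> pr j \<subseteq> pr i"
  shows "\<exists>j\<in>C. \<forall>i\<in>C. pr j \<subseteq> pr i"
proof -
  obtain j where j: "j \<in> C" "\<forall>i\<in>C. pr i \<subseteq> pr j \<longrightarrow> pr j = pr i"
    using finite_has_minimal[of "pr ` C"] assms(1,2) by auto
  then have "\<forall>i\<in>C. pr j \<subseteq> pr i" using assms(3) by auto
  then show ?thesis using j(1) by auto
qed

text \<open>Join-irreducible elements are ordered by inclusion of their principal ideals. As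
  \<open>pr\<close> is injective, the chain can be sought among these sets, which carry a type class
  order.\<close>

lemma chain_exists:
  assumes V: "V \<subseteq> \<Union>L" "width_le k V" and T: "finite T" "T \<subseteq> V" "k * n < card T"
  shows "\<exists>C\<subseteq>T. card C = Suc n \<and> (\<forall>i\<in>C. \<forall>j\<in>C. pr i \<subseteq> pr j \<or> pr j \<subseteq> pr i)"
proof -
  have inj: "inj_on pr T" using pr_inj V T by (meson inj_on_subset)
  have "\<exists>C\<subseteq>pr ` T. card C = Suc n \<and> (\<forall>x\<in>C. \<forall>y\<in>C. x \<le> y \<or> y \<le> x)"
  proof (rule chain_if_antichains_small)
    show "k * n < card (pr ` T)" using T inj by (simp add: card_image)
    fix U assume U: "U \<subseteq> pr ` T" and anti: "\<And>x y. x \<in> U \<Longrightarrow> y \<in> U \<Longrightarrow> x \<le> y \<Longrightarrow> x = y"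
    obtain U' where U': "U' \<subseteq> T" "U = pr ` U'" using U by (meson subset_image_iff)
    have "antichain U'"
      unfolding antichain_def
    proof (intro ballI impI notI)
      fix i j assume ij: "i \<in> U'" "j \<in> U'" "i \<noteq> j" "pr i \<subseteq> pr j"
      then have "pr i = pr j" using anti[of "pr i" "pr j"] U'(2) by simp
      then show False using inj_onD[OF inj] ij U'(1) by blast
    qed
    then have "card U' \<le> k" using V(2) U' T finite_subset unfolding width_le_def by blast
    then show "card U \<le> k" using U' T
      by (meson card_image_le finite_subset le_trans)
  qed (use T in auto)
  then obtain C where C: "C \<subseteq> pr ` T" "card C = Suc n" "\<forall>x\<in>C. \<forall>y\<in>C. x \<le> y \<or> y \<le> x" by auto
  then obtain C' where C': "C' \<subseteq> T" "C = pr ` C'" by (meson subset_image_iff)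
  have "card C' = Suc n" using C C' inj by (metis card_image inj_on_subset)
  then show ?thesis using C C' by (intro exI[of _ C']) auto
qed

text \<open>\<open>x\<close> is the union of \<open>u\<close> and the principal ideals of the
  maximal elements of \<open>x - u\<close>; these form an antichain in \<open>V\<close>, so there
  are at most \<open>k\<close> of them.\<close>

lemma in_joins:
  assumes u: "u \<in> L" and x: "x \<in> L" "u \<subseteq> x" and V: "x - u \<subseteq> V" "width_le k V"
  shows "x \<in> joins u V k"
proof -
  define B where "B = {j \<in> x - u. \<forall>i\<in>x - u. pr j \<subseteq> pr i \<longrightarrow> j = i}"
  have fin: "finite x" using finite_mem x by simp
  have "antichain B" by (auto simp: B_def antichain_def)
  then have card: "card B \<le> k" using V fin unfolding width_le_def B_def
    by (metis (no_types, lifting) finite_Diff finite_subset mem_Collect_eq subset_eq)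
  have "\<exists>j\<in>B. i \<in> pr j" if i: "i \<in> x - u" for i
  proof -
    have "finite (pr ` {j \<in> x - u. pr i \<subseteq> pr j})" "pr ` {j \<in> x - u. pr i \<subseteq> pr j} \<noteq> {}"
      using fin i by auto
    then obtain j where j: "j \<in> x - u" "pr i \<subseteq> pr j"
        "\<forall>l\<in>x - u. pr i \<subseteq> pr l \<longrightarrow> pr j \<subseteq> pr l \<longrightarrow> pr j = pr l"
      using finite_has_maximal[of "pr ` {j \<in> x - u. pr i \<subseteq> pr j}"] by auto
    have "j = l" if "l \<in> x - u" "pr j \<subseteq> pr l" for l
    proof (rule inj_onD[OF pr_inj])
      show "pr j = pr l" using j that by blast
    qed (use j that x in auto)
    then have "j \<in> B" using j(1) by (auto simp: B_def)
    then show ?thesis using j(2) in_pr[of i] i x by blast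
  qed
  moreover have "pr j \<subseteq> x" if "j \<in> B" for j using that x pr_subset by (auto simp: B_def)
  ultimately have "x = u \<union> \<Union>(pr ` B)" using x(2) by blast
  moreover have "B \<subseteq> V" "finite B" using V fin by (auto simp: B_def)
  ultimately show ?thesis using card by (auto simp: joins_def)
qed

text \<open>Induction on the width. By \<open>in_joins\<close> and \<open>coverable_joins\<close> it
  suffices to cover the generators \<open>u \<union> pr j\<close>, hence to bound separated families
  of them. A family that is too large contains a long chain, to which the splitting along a path
  applies.\<close>

lemma coverable_of_width:
  assumes "u \<in> L" and "S \<subseteq> L" and "\<forall>x\<in>S. u \<subseteq> x" and "width_le k (\<Union>S - u)"
    and "\<And>j. j \<in> \<Union>S \<Longrightarrow> \<exists>a. step_path M a \<and> j \<in> a M"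
  shows "coverable D S (cover_number M k) (cover_radius K k * s)"
  using assms
proof (induction k arbitrary: u S)
  case 0
  have "x = u" if "x \<in> S" for x
  proof (rule ccontr)
    assume "x \<noteq> u"
    moreover have "u \<subseteq> x" using 0(3) that by blast
    ultimately obtain j where "j \<in> x - u" by blast
    moreover have "antichain {j}" by (auto simp: antichain_def)
    ultimately show False using 0(4) that unfolding width_le_def by (auto dest!: spec[of _ "{j}"])
  qed
  then have "D x y \<le> 0" if "x \<in> S" "y \<in> S" for x y
    using D_self[OF 0(1)] that by (metis order_refl)
  then show ?case unfolding coverable_def by (intro exI[of _ "\<lambda>_. 0"]) auto
next
  case (Suc k)
  note u = Suc.prems(1) and S = Suc.prems(2,3) and width = Suc.prems(4) and paths = Suc.prems(5)
  define V where "V = \<Union>S - u"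
  define c where "c = cover_radius K k + 2 * (K\<^sup>2 + K + 1)"
  define n where "n = Suc k * (M * cover_number M k)"
  have V: "V \<subseteq> \<Union>L" "width_le (Suc k) V" using S width by (auto simp: V_def)
  have c: "0 \<le> c" using K_nonneg cover_radius_nonneg by (simp add: c_def)
  have ZL: "(\<lambda>j. u \<union> pr j) ` V \<subseteq> L" using u V pr_mem Un_mem by auto
  have cov: "coverable D ((\<lambda>j. u \<union> pr j) ` V) n (2 * (c * s))"
  proof (rule coverable_if_separated_small)
    fix Z assume Z: "finite Z" "Z \<subseteq> (\<lambda>j. u \<union> pr j) ` V"
      and sep: "\<And>x y. x \<in> Z \<Longrightarrow> y \<in> Z \<Longrightarrow> x \<noteq> y \<Longrightarrow> c * s < D x y"
    obtain T where T: "T \<subseteq> V" "Z = (\<lambda>j. u \<union> pr j) ` T" "inj_on (\<lambda>j. u \<union> pr j) T"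
      using Z(2) by (metis subset_image_inj)
    have finT: "finite T" using Z(1) T finite_imageD by blast
    show "card Z \<le> n"
    proof (rule ccontr)
      assume "\<not> card Z \<le> n"
      then have "n < card T" using T finT by (simp add: card_image)
      then obtain C where C: "C \<subseteq> T" "card C = Suc (M * cover_number M k)"
          "\<forall>i\<in>C. \<forall>j\<in>C. pr i \<subseteq> pr j \<or> pr j \<subseteq> pr i"
        using chain_exists[OF V finT T(1), of "M * cover_number M k"] unfolding n_def by auto
      have finC: "finite C" and "C \<noteq> {}" using C(2) by (auto intro: card_ge_0_finite)
      then obtain top where top: "top \<in> C" "\<forall>i\<in>C. pr i \<subseteq> pr top"
        using chain_top[OF _ _ C(3)] by auto
      have "top \<in> \<Union>S" using top(1) C(1) T(1) by (auto simp: V_def)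
      then obtain a where a: "step_path M a" "top \<in> a M"
        using paths by blast
      have aL: "a t \<in> L" if "t \<le> M" for t using a that by (auto simp: step_path_def)
      have CM: "C \<subseteq> a M"
      proof
        fix i assume "i \<in> C"
        then have "i \<in> pr top" using top in_pr[of i] C T V by blast
        then show "i \<in> a M" using pr_subset[OF aL a(2)] by auto
      qed
      \<comment> \<open>The path need not be monotone; for each \<open>i\<close> only one step at
        which \<open>i\<close> enters is recorded.\<close>
      have "\<exists>t<M. i \<notin> a t \<and> i \<in> a (Suc t)" if "i \<in> C" for i
      proof -
        have "i \<notin> a 0" "i \<in> a M" using a that CM by (auto simp: step_path_def)
        then obtain t where t: "t < M" "\<forall>r\<le>t. i \<notin> a r" "i \<in> a (Suc t)"
          using ex_least_nat_less[of "\<lambda>t. i \<in> a t" M] by blast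
        then show ?thesis by blast
      qed
      then obtain \<tau> where \<tau>: "\<And>i. i \<in> C \<Longrightarrow> \<tau> i < M \<and> i \<notin> a (\<tau> i) \<and> i \<in> a (Suc (\<tau> i))"
        by metis
      obtain t where t: "t < M" "cover_number M k < card {i \<in> C. \<tau> i = t}"
        using pigeonhole_fibre[OF finC, of \<tau> M "cover_number M k"] \<tau> C(2) by auto
      define C' where "C' = {i \<in> C. \<tau> i = t}"
      have "C' \<noteq> {}" using t(2) by (metis C'_def card.empty not_less0)
      then have C': "C' \<subseteq> C" "finite C'" "C' \<noteq> {}" using finC by (auto simp: C'_def)
      have at: "i \<notin> a t" "i \<in> a (Suc t)" if "i \<in> C'" for i
        using \<tau>[of i] that by (auto simp: C'_def)
      have C'V: "C' \<subseteq> V" using C' C T by auto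
      obtain bot where bot: "bot \<in> C'" "\<forall>i\<in>C'. pr bot \<subseteq> pr i"
        using chain_bot[OF C'(2,3)] C(3) C'(1) by (meson subsetD)
      \<comment> \<open>\<open>x j\<close> is the generator of \<open>j\<close> cut down to the
        beginning of the common step \<open>t\<close>, but kept above \<open>u\<close>.\<close>
      define x where "x j = (u \<union> pr j) \<inter> (u \<union> a t)" for j
      have ut: "u \<union> a t \<in> L" "u \<union> a (Suc t) \<in> L" using u aL t Un_mem by auto
      have zL: "u \<union> pr j \<in> L" if "j \<in> C'" for j using that C'V ZL by auto
      have xL: "x j \<in> L" if "j \<in> C'" for j using zL[OF that] ut Int_mem by (simp add: x_def)
      have pr_sub: "pr j \<subseteq> \<Union>S" if "j \<in> C'" for j
        using that C'V S pr_subset unfolding V_def by blast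
      \<comment> \<open>An antichain in this region can be enlarged by \<open>bot\<close>: its
        elements lie in \<open>a t\<close>, which does not contain \<open>bot\<close>, and none of
        them lies in \<open>pr bot\<close>. Hence the width drops by one.\<close>
      have width': "width_le k (\<Union>(x ` C') - x bot)"
        unfolding width_le_def
      proof (intro allI impI)
        fix T' assume T': "T' \<subseteq> \<Union>(x ` C') - x bot" "finite T'" "antichain T'"
        have incomp: "bot \<notin> pr i \<and> i \<notin> pr bot \<and> i \<in> V" if iT: "i \<in> T'" for i
        proof -
          obtain j where j: "j \<in> C'" "i \<in> x j" "i \<notin> x bot" using iT T'(1) by blast
          then have i: "i \<notin> u" "i \<in> pr j" "i \<in> a t" by (auto simp: x_def)
          have "bot \<notin> pr i" using pr_subset[OF aL \<open>i \<in> a t\<close>] t at[OF bot(1)] by auto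
          moreover have "i \<notin> pr bot" using i j by (auto simp: x_def)
          moreover have "i \<in> V" using i pr_sub[OF j(1)] by (auto simp: V_def)
          ultimately show ?thesis by simp
        qed
        have "antichain (insert bot T')"
        proof -
          have "\<not> pr bot \<subseteq> pr i" "\<not> pr i \<subseteq> pr bot" if "i \<in> T'" for i
            using incomp[OF that] in_pr[of bot] in_pr[of i] V(1) bot(1) C'V by blast+
          then show ?thesis using T'(3) by (auto simp: antichain_def)
        qed
        moreover have "insert bot T' \<subseteq> V" using incomp bot(1) C'V by auto
        ultimately have "card (insert bot T') \<le> Suc k"
          using V(2) T'(2) by (auto simp: width_le_def)
        moreover have "bot \<notin> T'" using incomp in_pr[of bot] V(1) bot(1) C'V by blast
        ultimately show "card T' \<le> k" using T'(2) by simp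
      qed
      have "coverable D (x ` C') (cover_number M k) (cover_radius K k * s)"
      proof (rule Suc.IH[OF _ _ _ width'])
        show "x bot \<in> L" "x ` C' \<subseteq> L" using xL bot by auto
        show "\<forall>y\<in>x ` C'. x bot \<subseteq> y" using bot(2) by (auto simp: x_def)
        fix j assume "j \<in> \<Union>(x ` C')"
        then obtain l where l: "l \<in> C'" "j \<in> u \<union> pr l" unfolding x_def by blast
        have "bot \<in> \<Union>S" using bot(1) C'V by (auto simp: V_def)
        then have "u \<subseteq> \<Union>S" using S(2) by blast
        then have "j \<in> \<Union>S" using l pr_sub[OF l(1)] by blast
        then show "\<exists>a. step_path M a \<and> j \<in> a M" by (rule paths)
      qed
      then obtain i j where ij: "i \<in> C'" "j \<in> C'" "i \<noteq> j" "D (x i) (x j) \<le> cover_radius K k * s"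
        using coverable_pigeonhole[OF _ C'(2)] t(2)[folded C'_def] by blast
      \<comment> \<open>Since \<open>pr l\<close> lies below \<open>a (Suc t)\<close>, intersecting
        with \<open>u \<union> a (Suc t)\<close> changes nothing. Replacing \<open>a (Suc t)\<close>
        by \<open>a t\<close> costs \<open>K + 1\<close> units by \<open>D_Un\<close>, which become
        \<open>K * (K + 1) + 1\<close> by \<open>D_Int\<close>.\<close>
      have close: "D (u \<union> pr l) (x l) \<le> (K\<^sup>2 + K + 1) * s" if "l \<in> C'" for l
      proof -
        have "u \<union> pr l = (u \<union> pr l) \<inter> (u \<union> a (Suc t))"
          using pr_subset[OF aL at(2)[OF that]] t by auto
        then have "D (u \<union> pr l) (x l) \<le> K * (D (u \<union> pr l) (u \<union> pr l)
            + D (u \<union> a (Suc t)) (u \<union> a t)) + s"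
          unfolding x_def using D_Int[of "u \<union> pr l" "u \<union> pr l" "u \<union> a (Suc t)" "u \<union> a t"]
            zL[OF that] ut by simp
        moreover have "D (u \<union> pr l) (u \<union> pr l) = 0" "D u u = 0"
          using D_self zL[OF that] u by auto
        moreover have "D (u \<union> a (Suc t)) (u \<union> a t) \<le> K * (D u u + D (a (Suc t)) (a t)) + s"
          using D_Un u aL t by simp
        moreover have "D (a (Suc t)) (a t) \<le> s"
          using a t D_sym[of "a t" "a (Suc t)"] aL by (auto simp: step_path_def)
        ultimately have "D (u \<union> a (Suc t)) (u \<union> a t) \<le> K * s + s"
            "D (u \<union> pr l) (x l) \<le> K * D (u \<union> a (Suc t)) (u \<union> a t) + s"
          using K_nonneg by (auto intro: order_trans[OF _ add_right_mono] mult_left_mono)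
        then have "D (u \<union> pr l) (x l) \<le> K * (K * s + s) + s"
          using mult_left_mono[OF _ K_nonneg] by (meson add_right_mono order_trans)
        then show ?thesis by (simp add: algebra_simps power2_eq_square)
      qed
      have "D (u \<union> pr i) (u \<union> pr j) \<le> D (u \<union> pr i) (x i) + D (x i) (x j) + D (x j) (u \<union> pr j)"
        using D_tri[of "u \<union> pr i" "x i" "u \<union> pr j"] D_tri[of "x i" "x j" "u \<union> pr j"] zL xL ij by simp
      also have "\<dots> \<le> c * s"
        using close[OF ij(1)] close[OF ij(2)] ij(4) D_sym[of "x j" "u \<union> pr j"] zL xL ij
        by (simp add: c_def algebra_simps)
      finally have "D (u \<union> pr i) (u \<union> pr j) \<le> c * s" .
      moreover have "i \<in> T" "j \<in> T" using ij C' C by auto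
      moreover have "u \<union> pr i \<noteq> u \<union> pr j" using T(3) ij \<open>i \<in> T\<close> \<open>j \<in> T\<close> by (auto dest: inj_onD)
      ultimately show False using sep[of "u \<union> pr i" "u \<union> pr j"] T(2) by auto
    qed
  next
    fix x assume "x \<in> (\<lambda>j. u \<union> pr j) ` V"
    then show "D x x \<le> c * s" using ZL D_self c s_nonneg by (metis mult_nonneg_nonneg subsetD)
  qed (use ZL D_sym D_tri in \<open>auto simp: subset_iff\<close>)
  have "coverable D (joins u V (Suc k)) (Suc n ^ Suc k) (join_radius K (2 * c) (Suc k) * s)"
    using cov c by (intro coverable_joins[OF u V(1)]) (auto simp: mult.assoc)
  moreover have "S \<subseteq> joins u V (Suc k)"
  proof
    fix x assume "x \<in> S"
    then show "x \<in> joins u V (Suc k)" using S V u by (intro in_joins) (auto simp: V_def)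
  qed
  ultimately show ?case unfolding cover_radius.simps cover_number.simps c_def n_def
    by (rule coverable_mono) auto
qed

end

section \<open>Intervals in finite median algebras\<close>

context median_algebra
begin

lemma swap_last: "a \<in> \<Phi> \<Longrightarrow> b \<in> \<Phi> \<Longrightarrow> c \<in> \<Phi> \<Longrightarrow> \<mu> a b c = \<mu> a c b"
  by (metis M1_rotate M1_swap)

lemma M2_outer: "a \<in> \<Phi> \<Longrightarrow> b \<in> \<Phi> \<Longrightarrow> \<mu> a b a = a"
  by (metis M1_rotate M2)

lemma M2_last: "a \<in> \<Phi> \<Longrightarrow> b \<in> \<Phi> \<Longrightarrow> \<mu> a b b = b"
  by (metis M1_rotate M2)

lemma gate_idem:
  assumes "a \<in> \<Phi>" "b \<in> \<Phi>" "c \<in> \<Phi>"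
  shows "\<mu> a b (\<mu> a b c) = \<mu> a b c"
  using assms M3[of a b a b c] by (simp add: M2_outer M2_last)

text \<open>M3 lets the projection \<open>\<mu> a b\<close> act on two of the three arguments. A
  second application, after the third argument is rotated to the front, reaches that one as well,
  and idempotence removes the repetition.\<close>

lemma gate_hom:
  assumes a: "a \<in> \<Phi>" "b \<in> \<Phi>" and c: "c \<in> \<Phi>" "d \<in> \<Phi>" "e \<in> \<Phi>"
  shows "\<mu> a b (\<mu> c d e) = \<mu> (\<mu> a b c) (\<mu> a b d) (\<mu> a b e)"
proof -
  let ?r = "\<mu> a b"
  have r: "?r c \<in> \<Phi>" "?r d \<in> \<Phi>" "?r e \<in> \<Phi>" using assms closed by auto
  have "?r (\<mu> c d e) = ?r (?r (\<mu> c d e))" using assms by (simp add: closed gate_idem)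
  also have "\<dots> = ?r (\<mu> (?r c) (?r d) e)" using assms by (simp add: M3)
  also have "\<dots> = ?r (\<mu> e (?r c) (?r d))" using r c M1_rotate[of e "?r c" "?r d"] by simp
  also have "\<dots> = \<mu> (?r e) (?r (?r c)) (?r d)" using a c r by (intro M3)
  also have "\<dots> = \<mu> (?r c) (?r d) (?r e)"
    using r M1_rotate[of "?r e" "?r c" "?r d"] assms by (simp add: gate_idem)
  finally show ?thesis .
qed

end

section \<open>The interval as a finite distributive lattice\<close>

locale median_interval_lattice = median_algebra \<Phi> \<mu>
  for \<Phi> :: "'a set" and \<mu> :: "'a \<Rightarrow> 'a \<Rightarrow> 'a \<Rightarrow> 'a" +
  fixes p q :: 'a
  assumes p: "p \<in> \<Phi>" and q: "q \<in> \<Phi>" and fin: "finite \<Phi>"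
begin

definition I :: "'a set" where
  "I = median_interval \<Phi> \<mu> p q"

text \<open>With \<open>p\<close> as bottom and \<open>q\<close> as top, the median with
  \<open>p\<close> is the meet and the median with \<open>q\<close> is the join of the
  interval.\<close>

definition meet :: "'a \<Rightarrow> 'a \<Rightarrow> 'a" where
  "meet a b = \<mu> p a b"

definition join :: "'a \<Rightarrow> 'a \<Rightarrow> 'a" where
  "join a b = \<mu> a b q"

definition le :: "'a \<Rightarrow> 'a \<Rightarrow> bool" where
  "le a b \<longleftrightarrow> meet a b = a"

lemma in_I_iff: "a \<in> I \<longleftrightarrow> a \<in> \<Phi> \<and> \<mu> p q a = a"
  by (simp add: I_def median_interval_def)

lemma I_carrier: "a \<in> I \<Longrightarrow> a \<in> \<Phi>"
  by (simp add: in_I_iff)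

lemma finite_I: "finite I"
  using fin finite_subset I_carrier by (metis subsetI)

lemma gate_in_I: "a \<in> \<Phi> \<Longrightarrow> \<mu> p q a \<in> I"
  by (simp add: in_I_iff closed gate_idem p q)

lemma p_in_I: "p \<in> I" and q_in_I: "q \<in> I"
  using p q by (simp_all add: in_I_iff M2_outer M2_last)

lemma median_in_I: "a \<in> I \<Longrightarrow> b \<in> I \<Longrightarrow> c \<in> I \<Longrightarrow> \<mu> a b c \<in> I"
  using gate_hom[of p q a b c] p q by (simp add: in_I_iff closed)

lemma meet_in_I: "a \<in> I \<Longrightarrow> b \<in> I \<Longrightarrow> meet a b \<in> I"
  and join_in_I: "a \<in> I \<Longrightarrow> b \<in> I \<Longrightarrow> join a b \<in> I"
  unfolding meet_def join_def by (simp_all add: median_in_I p_in_I q_in_I)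

lemma meet_commute: "a \<in> I \<Longrightarrow> b \<in> I \<Longrightarrow> meet a b = meet b a"
  unfolding meet_def using swap_last p I_carrier by metis

lemma join_commute: "a \<in> I \<Longrightarrow> b \<in> I \<Longrightarrow> join a b = join b a"
  unfolding join_def using M1_swap q I_carrier by metis

lemma meet_assoc: "a \<in> I \<Longrightarrow> b \<in> I \<Longrightarrow> c \<in> I \<Longrightarrow> meet a (meet b c) = meet (meet a b) c"
  unfolding meet_def using M3[of p a p b c] p I_carrier by (simp add: M2_outer)

lemma meet_join_distrib:
  "a \<in> I \<Longrightarrow> b \<in> I \<Longrightarrow> c \<in> I \<Longrightarrow> meet a (join b c) = join (meet a b) (meet a c)"
  unfolding meet_def join_def using M3[of p a b c q] p q I_carrier by simp

lemma meet_q: "a \<in> I \<Longrightarrow> meet a q = a"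
  unfolding meet_def using swap_last[of p a q] p q by (simp add: in_I_iff)

lemma join_p: "a \<in> I \<Longrightarrow> join p a = a"
  unfolding join_def using swap_last[of p a q] p q by (simp add: in_I_iff)

lemma absorb: "a \<in> I \<Longrightarrow> b \<in> I \<Longrightarrow> meet a (join a b) = a"
proof -
  assume ab: "a \<in> I" "b \<in> I"
  have "\<mu> p a (\<mu> a q b) = \<mu> (\<mu> p a a) (\<mu> p a q) b"
    using ab p q I_carrier by (intro M3) auto
  also have "\<dots> = a" using ab p q I_carrier meet_q[of a] by (simp add: meet_def M2 M2_last)
  finally show ?thesis unfolding meet_def join_def using ab swap_last q I_carrier by metis
qed

lemma le_refl: "a \<in> I \<Longrightarrow> le a a"
  unfolding le_def meet_def using p I_carrier by (simp add: M2_last)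

lemma le_antisym: "a \<in> I \<Longrightarrow> b \<in> I \<Longrightarrow> le a b \<Longrightarrow> le b a \<Longrightarrow> a = b"
  unfolding le_def using meet_commute by metis

lemma le_trans: "a \<in> I \<Longrightarrow> b \<in> I \<Longrightarrow> c \<in> I \<Longrightarrow> le a b \<Longrightarrow> le b c \<Longrightarrow> le a c"
  unfolding le_def using meet_assoc by metis

lemma p_le: "a \<in> I \<Longrightarrow> le p a"
  unfolding le_def meet_def using p I_carrier by (simp add: M2)

lemma le_q: "a \<in> I \<Longrightarrow> le a q"
  unfolding le_def by (rule meet_q)

lemma meet_le: "a \<in> I \<Longrightarrow> b \<in> I \<Longrightarrow> le (meet a b) a" "a \<in> I \<Longrightarrow> b \<in> I \<Longrightarrow> le (meet a b) b"
proof -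
  show "le (meet a b) b" if "a \<in> I" "b \<in> I" for a b
    using that meet_assoc[of a b b] le_refl[of b] by (simp add: le_def)
  then show "le (meet a b) a" if "a \<in> I" "b \<in> I" for a b
    using that meet_commute by metis
qed

lemma le_meet_iff:
  assumes "a \<in> I" "b \<in> I" "c \<in> I"
  shows "le a (meet b c) \<longleftrightarrow> le a b \<and> le a c"
proof
  assume "le a (meet b c)"
  then show "le a b \<and> le a c" using assms meet_le le_trans meet_in_I by metis
next
  assume "le a b \<and> le a c"
  then show "le a (meet b c)" using assms meet_assoc[of a b c] by (simp add: le_def)
qed

lemma le_join: "a \<in> I \<Longrightarrow> b \<in> I \<Longrightarrow> le a (join a b)" "a \<in> I \<Longrightarrow> b \<in> I \<Longrightarrow> le b (join a b)"
  using absorb join_commute unfolding le_def by metis+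

lemma join_le: "a \<in> I \<Longrightarrow> b \<in> I \<Longrightarrow> c \<in> I \<Longrightarrow> le a c \<Longrightarrow> le b c \<Longrightarrow> le (join a b) c"
  using meet_join_distrib[of c a b] meet_commute[of c] join_in_I[of a b] unfolding le_def by metis

text \<open>Join-prime elements, which in a distributive lattice are the join-irreducible ones.
  Primeness makes \<open>ideal\<close> turn joins into unions, and excluding \<open>p\<close> gives
  \<open>ideal p = {}\<close>.\<close>

definition J :: "'a set" where
  "J = {j \<in> I. j \<noteq> p \<and> (\<forall>a\<in>I. \<forall>b\<in>I. le j (join a b) \<longrightarrow> le j a \<or> le j b)}"

text \<open>Birkhoff's representation of a distributive lattice by sets of join-primes.\<close>

definition ideal :: "'a \<Rightarrow> 'a set" where
  "ideal a = {j \<in> J. le j a}"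

lemma J_in_I: "j \<in> J \<Longrightarrow> j \<in> I"
  by (simp add: J_def)

lemma ideal_meet: "a \<in> I \<Longrightarrow> b \<in> I \<Longrightarrow> ideal (meet a b) = ideal a \<inter> ideal b"
  by (auto simp: ideal_def le_meet_iff J_in_I)

lemma ideal_join:
  assumes "a \<in> I" "b \<in> I"
  shows "ideal (join a b) = ideal a \<union> ideal b"
proof (intro equalityI subsetI)
  fix j assume "j \<in> ideal (join a b)"
  then show "j \<in> ideal a \<union> ideal b" using assms by (auto simp: ideal_def J_def)
next
  fix j assume "j \<in> ideal a \<union> ideal b"
  then show "j \<in> ideal (join a b)"
    using assms le_join[OF assms] join_in_I[OF assms] by (auto simp: ideal_def J_in_I intro: le_trans)
qed

lemma ideal_p: "ideal p = {}"
  using le_antisym p_in_I p_le by (auto simp: ideal_def J_def)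

text \<open>A minimal \<open>j\<close> among the elements below \<open>a\<close> but not below
  \<open>b\<close> is prime: if \<open>j\<close> were below \<open>join c d\<close> but below
  neither \<open>c\<close> nor \<open>d\<close>, its meets with \<open>c\<close> and
  \<open>d\<close> would be strictly smaller, hence below \<open>b\<close>, and so would be their
  join, which is \<open>j\<close>.\<close>

lemma separating_prime:
  assumes a: "a \<in> I" and b: "b \<in> I" and ab: "\<not> le a b"
  shows "\<exists>j\<in>J. le j a \<and> \<not> le j b"
proof -
  define V where "V = {x \<in> I. le x a \<and> \<not> le x b}"
  have "a \<in> V" using assms by (simp add: V_def le_refl)
  \<comment> \<open>Minimality is expressed by the number of elements below, as \<open>I\<close> is
    finite.\<close>
  then obtain j where j: "j \<in> V" and jmin: "\<And>x. x \<in> V \<Longrightarrow>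
      card {z \<in> I. le z j} \<le> card {z \<in> I. le z x}"
    using ex_has_least_nat[of "\<lambda>x. x \<in> V" a "\<lambda>x. card {z \<in> I. le z x}"] by auto
  have jI: "j \<in> I" "le j a" "\<not> le j b" using j by (auto simp: V_def)
  have below: "le x b" if x: "x \<in> I" "le x j" "x \<noteq> j" for x
  proof (rule ccontr)
    assume "\<not> le x b"
    then have "x \<in> V" using x le_trans[OF x(1) jI(1) a x(2) jI(2)] by (simp add: V_def)
    moreover have "{z \<in> I. le z x} \<subset> {z \<in> I. le z j}"
    proof (rule psubsetI)
      show "{z \<in> I. le z x} \<subseteq> {z \<in> I. le z j}" using x jI(1) le_trans[of _ x j] by blast
      have "j \<notin> {z \<in> I. le z x}" using x jI(1) le_antisym[of j x] by blast
      then show "{z \<in> I. le z x} \<noteq> {z \<in> I. le z j}" using jI(1) le_refl[of j] by blast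
    qed
    then have "card {z \<in> I. le z x} < card {z \<in> I. le z j}"
      using finite_I by (intro psubset_card_mono) auto
    ultimately show False using jmin by fastforce
  qed
  have "j \<in> J" unfolding J_def
  proof (intro CollectI conjI ballI impI)
    show "j \<noteq> p" using jI(3) p_le[OF b] by auto
    fix c d assume cd: "c \<in> I" "d \<in> I" "le j (join c d)"
    show "le j c \<or> le j d"
    proof (rule ccontr)
      assume neg: "\<not> (le j c \<or> le j d)"
      have "le (meet j c) b" "le (meet j d) b"
        using below[of "meet j c"] below[of "meet j d"] neg cd jI meet_in_I meet_le
        by (auto simp: le_def)
      then have "le (join (meet j c) (meet j d)) b" using cd jI b by (intro join_le meet_in_I) auto
      moreover have "join (meet j c) (meet j d) = j"
        using cd jI meet_join_distrib[of j c d] by (simp add: le_def)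
      ultimately show False using jI by simp
    qed
  qed (use jI in auto)
  then show ?thesis using jI by blast
qed

lemma ideal_subset_iff: "a \<in> I \<Longrightarrow> b \<in> I \<Longrightarrow> ideal a \<subseteq> ideal b \<longleftrightarrow> le a b"
proof
  assume ab: "a \<in> I" "b \<in> I" and sub: "ideal a \<subseteq> ideal b"
  show "le a b"
  proof (rule ccontr)
    assume "\<not> le a b"
    then obtain j where "j \<in> J" "le j a" "\<not> le j b" using separating_prime ab by blast
    then show False using sub by (auto simp: ideal_def)
  qed
next
  assume "a \<in> I" "b \<in> I" and "le a b"
  then show "ideal a \<subseteq> ideal b" by (auto simp: ideal_def intro: le_trans J_in_I)
qed

lemma inj_on_ideal: "inj_on ideal I"
proof (rule inj_onI)
  fix a b assume "a \<in> I" "b \<in> I" "ideal a = ideal b"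
  then show "a = b" using ideal_subset_iff[of a b] ideal_subset_iff[of b a] le_antisym by simp
qed

text \<open>The preimage of the principal filter of \<open>j\<close> under the projection to the
  interval.\<close>

definition half :: "'a \<Rightarrow> 'a set" where
  "half j = {w \<in> \<Phi>. le j (\<mu> p q w)}"

text \<open>The projection preserves medians, so convexity can be checked in the interval. The
  filter of \<open>j\<close> is convex because meeting with \<open>j\<close> preserves medians, its
  complement because \<open>j\<close> is join-prime.\<close>

lemma half_wall:
  assumes j: "j \<in> J"
  shows "wall \<Phi> \<mu> {half j, \<Phi> - half j}"
proof -
  have jI: "j \<in> I" "j \<in> \<Phi>" using j J_in_I I_carrier by auto
  have qh: "q \<in> half j" using q p jI le_q by (simp add: half_def M2_last)
  have ph: "p \<in> \<Phi> - half j"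
    using j p q p_le[OF jI(1)] le_antisym[OF jI(1) p_in_I] by (auto simp: half_def M2_outer J_def)
  have conv: "median_convex \<Phi> \<mu> (half j)"
    unfolding median_convex_def
  proof (intro conjI ballI subsetI)
    fix a b c assume ab: "a \<in> half j" "b \<in> half j" and c: "c \<in> median_interval \<Phi> \<mu> a b"
    let ?g = "\<mu> p q"
    have \<Phi>: "a \<in> \<Phi>" "b \<in> \<Phi>" "c \<in> \<Phi>" and abc: "\<mu> a b c = c"
      using ab c by (auto simp: half_def median_interval_def)
    have g: "?g a \<in> \<Phi>" "?g b \<in> \<Phi>" "?g c \<in> \<Phi>" using \<Phi> p q closed by auto
    have gc: "?g c = \<mu> (?g a) (?g b) (?g c)" using gate_hom[of p q a b c] \<Phi> p q abc by simp
    have "\<mu> p j (?g c) = \<mu> (\<mu> p j (?g a)) (\<mu> p j (?g b)) (?g c)"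
      by (subst gc) (use g jI p M3 in auto)
    also have "\<dots> = j" using ab g jI by (simp add: half_def le_def meet_def M2)
    finally show "c \<in> half j" using \<Phi> by (simp add: half_def le_def meet_def)
  qed (auto simp: half_def)
  have conv': "median_convex \<Phi> \<mu> (\<Phi> - half j)"
    unfolding median_convex_def
  proof (intro conjI ballI subsetI)
    fix a b c assume ab: "a \<in> \<Phi> - half j" "b \<in> \<Phi> - half j" and c: "c \<in> median_interval \<Phi> \<mu> a b"
    let ?g = "\<mu> p q"
    have \<Phi>: "a \<in> \<Phi>" "b \<in> \<Phi>" "c \<in> \<Phi>" and abc: "\<mu> a b c = c"
      using ab c by (auto simp: median_interval_def)
    have g: "?g a \<in> I" "?g b \<in> I" "?g c \<in> I" using \<Phi> gate_in_I by auto
    have gc: "?g c = \<mu> (?g a) (?g b) (?g c)" using gate_hom[of p q a b c] \<Phi> p q abc by simp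
    show "c \<in> \<Phi> - half j"
    proof (rule ccontr)
      assume "c \<notin> \<Phi> - half j"
      then have jc: "\<mu> p j (?g c) = j" using \<Phi> by (simp add: half_def le_def meet_def)
      \<comment> \<open>Projecting the median to the interval from \<open>p\<close> to
        \<open>j\<close> gives \<open>j = \<mu> \<alpha> \<beta> j\<close>, and this is
        \<open>meet j (join \<alpha> \<beta>)\<close>. Primeness then puts \<open>j\<close> below
        one of the two projections.\<close>
      define \<alpha> \<beta> where "\<alpha> = meet j (?g a)" and "\<beta> = meet j (?g b)"
      have \<alpha>\<beta>: "\<alpha> \<in> I" "\<beta> \<in> I" using g jI meet_in_I by (auto simp: \<alpha>_def \<beta>_def)
      have "j = \<mu> p j (\<mu> (?g a) (?g b) (?g c))" using jc gc by simp
      also have "\<dots> = \<mu> \<alpha> \<beta> j"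
        using gate_hom[of p j "?g a" "?g b" "?g c"] g jI p I_carrier jc
        by (simp add: \<alpha>_def \<beta>_def meet_def)
      also have "\<dots> = meet j (join \<alpha> \<beta>)"
      proof -
        have "meet j \<alpha> = \<alpha>" "meet j \<beta> = \<beta>"
          using g jI meet_assoc[of j j] le_refl[of j] by (simp_all add: \<alpha>_def \<beta>_def le_def)
        moreover have "\<mu> p j (\<mu> \<alpha> \<beta> q) = \<mu> (\<mu> p j \<alpha>) (\<mu> p j \<beta>) (\<mu> p j q)"
          using \<alpha>\<beta> I_carrier jI p q by (intro gate_hom) auto
        ultimately show ?thesis using meet_q[OF jI(1)] by (simp add: meet_def join_def)
      qed
      finally have "le j (join \<alpha> \<beta>)" by (simp add: le_def)
      then have "le j \<alpha> \<or> le j \<beta>" using j \<alpha>\<beta> by (auto simp: J_def)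
      then have "le j (?g a) \<or> le j (?g b)"
        using g jI le_meet_iff[OF jI(1) jI(1)] by (auto simp: \<alpha>_def \<beta>_def)
      then show False using ab \<Phi> by (auto simp: half_def)
    qed
  qed auto
  have "half j \<noteq> \<Phi> - half j" using qh by auto
  then have "card {half j, \<Phi> - half j} = 2" by simp
  moreover have "partition_on \<Phi> {half j, \<Phi> - half j}"
    using qh ph by (auto simp: partition_on_def disjoint_def half_def)
  ultimately show ?thesis using conv conv' by (auto simp: wall_def)
qed

lemma mem_half_iff: "i \<in> J \<Longrightarrow> i \<in> half j \<longleftrightarrow> le j i"
  using J_in_I[of i] by (auto simp: half_def in_I_iff)

text \<open>For incomparable \<open>i\<close> and \<open>j\<close> the four quadrants of their walls
  contain \<open>q\<close>, \<open>p\<close>, \<open>i\<close> and \<open>j\<close>, so the walls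
  cross. They are distinct because a wall does not cross itself.\<close>

lemma incomparable_card:
  assumes rank: "median_rank_le \<Phi> \<mu> d" and T: "T \<subseteq> J"
    and anti: "\<And>i j. i \<in> T \<Longrightarrow> j \<in> T \<Longrightarrow> le i j \<Longrightarrow> i = j"
  shows "card T \<le> d"
proof (rule ccontr)
  assume "\<not> card T \<le> d"
  then obtain T' where T': "T' \<subseteq> T" "card T' = d + 1"
    by (metis obtain_subset_with_card_n not_less_eq_eq Suc_eq_plus1)
  define W where "W j = {half j, \<Phi> - half j}" for j
  have pq: "q \<in> half j" "p \<in> \<Phi> - half j" if "j \<in> J" for j
    using that J_in_I[OF that] p q le_q[of j] p_le[of j] le_antisym[of j p] p_in_I
    by (auto simp: half_def M2_last M2_outer J_def)
  have cross: "walls_cross (W i) (W j)" if "i \<in> T'" "j \<in> T'" "i \<noteq> j" for i j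
  proof -
    have ij: "i \<in> J" "j \<in> J" "\<not> le i j" "\<not> le j i" using that T' T anti by blast+
    have i\<Phi>: "i \<in> \<Phi>" "j \<in> \<Phi>" using ij J_in_I I_carrier by auto
    have refl: "le i i" "le j j" using ij J_in_I le_refl by auto
    have "q \<in> half i \<inter> half j" "p \<in> (\<Phi> - half i) \<inter> (\<Phi> - half j)"
      "i \<in> half i \<inter> (\<Phi> - half j)" "j \<in> (\<Phi> - half i) \<inter> half j"
      using pq ij i\<Phi> refl by (auto simp: mem_half_iff)
    then show ?thesis unfolding walls_cross_def W_def by blast
  qed
  have "inj_on W T'"
  proof (rule inj_onI, rule ccontr)
    fix i j assume ij: "i \<in> T'" "j \<in> T'" "W i = W j" "i \<noteq> j"
    then have "walls_cross (W i) (W i)" using cross by metis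
    then show False by (auto simp: walls_cross_def W_def)
  qed
  then have "card (W ` T') = d + 1" using T' by (simp add: card_image)
  moreover have "\<forall>A\<in>W ` T'. wall \<Phi> \<mu> A" using T' T half_wall by (auto simp: W_def)
  moreover have "pairwise walls_cross (W ` T')" using cross by (auto simp: pairwise_def)
  ultimately show False using rank unfolding median_rank_le_def by blast
qed

text \<open>\<open>ideal\<close> represents the interval as a coarse lattice of sets, whose union
  and intersection inherit the Lipschitz bound from medians with \<open>q\<close> and
  \<open>p\<close>. By \<open>incomparable_card\<close> the rank bounds the width, and
  \<open>coverable_of_width\<close> applies with base \<open>ideal p\<close>.\<close>

lemma interval_coverable:
  fixes dd :: "'a \<Rightarrow> 'a \<Rightarrow> real"
  assumes rank: "median_rank_le \<Phi> \<mu> d" and K: "0 \<le> K" and s: "0 \<le> s"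
    and self: "\<And>a. a \<in> \<Phi> \<Longrightarrow> dd a a = 0"
    and sym: "\<And>a b. a \<in> \<Phi> \<Longrightarrow> b \<in> \<Phi> \<Longrightarrow> dd a b = dd b a"
    and tri: "\<And>a b c. a \<in> \<Phi> \<Longrightarrow> b \<in> \<Phi> \<Longrightarrow> c \<in> \<Phi> \<Longrightarrow> dd a c \<le> dd a b + dd b c"
    and lip: "\<And>a b c a' b' c'. a \<in> \<Phi> \<Longrightarrow> b \<in> \<Phi> \<Longrightarrow> c \<in> \<Phi> \<Longrightarrow> a' \<in> \<Phi> \<Longrightarrow> b' \<in> \<Phi> \<Longrightarrow> c' \<in> \<Phi>
      \<Longrightarrow> dd (\<mu> a b c) (\<mu> a' b' c') \<le> K * (dd a a' + dd b b' + dd c c') + s"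
    and F: "F \<subseteq> I"
    and paths: "\<And>f. f \<in> F \<Longrightarrow> \<exists>a. (\<forall>t\<le>M. a t \<in> I) \<and> a 0 = p \<and> a M = f \<and>
      (\<forall>t<M. dd (a t) (a (Suc t)) \<le> s)"
  shows "coverable dd F (cover_number M d) (cover_radius K d * s)"
proof -
  define \<iota> where "\<iota> = the_inv_into I ideal"
  define D where "D A B = dd (\<iota> A) (\<iota> B)" for A B
  have \<iota>: "\<iota> (ideal a) = a" if "a \<in> I" for a
    unfolding \<iota>_def using inj_on_ideal that by (rule the_inv_into_f_f)
  have ideal_J: "j \<in> J \<Longrightarrow> j \<in> ideal j" for j by (simp add: ideal_def le_refl J_in_I)
  have UL: "\<Union>(ideal ` I) \<subseteq> J" by (auto simp: ideal_def)
  interpret coarse_set_lattice "ideal ` I" ideal D K s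
  proof
    show "finite A" if "A \<in> ideal ` I" for A
      using that finite_I by (auto simp: ideal_def J_def)
    show "A \<union> B \<in> ideal ` I" if "A \<in> ideal ` I" "B \<in> ideal ` I" for A B
      using that by (auto simp flip: ideal_join intro!: imageI join_in_I)
    show "A \<inter> B \<in> ideal ` I" if "A \<in> ideal ` I" "B \<in> ideal ` I" for A B
      using that by (auto simp flip: ideal_meet intro!: imageI meet_in_I)
    show "ideal j \<in> ideal ` I" "j \<in> ideal j" if "j \<in> \<Union>(ideal ` I)" for j
      using that UL J_in_I ideal_J by auto
    show "ideal j \<subseteq> A" if "A \<in> ideal ` I" "j \<in> A" for A j
    proof -
      obtain a where a: "a \<in> I" "A = ideal a" using \<open>A \<in> ideal ` I\<close> by auto
      then have "j \<in> J" "le j a" using that by (auto simp: ideal_def)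
      then show ?thesis using a ideal_subset_iff J_in_I by simp
    qed
    show "inj_on ideal (\<Union>(ideal ` I))"
      by (rule inj_on_subset[OF inj_on_ideal]) (use UL J_in_I in auto)
    show "D A A = 0" if "A \<in> ideal ` I" for A
      using that self I_carrier by (auto simp: D_def \<iota>)
    show "D A B = D B A" if "A \<in> ideal ` I" "B \<in> ideal ` I" for A B
      using that sym I_carrier by (auto simp: D_def \<iota>)
    show "D A C \<le> D A B + D B C" if "A \<in> ideal ` I" "B \<in> ideal ` I" "C \<in> ideal ` I" for A B C
      using that tri I_carrier by (auto simp: D_def \<iota>)
    fix A A' B B' assume "A \<in> ideal ` I" "A' \<in> ideal ` I" "B \<in> ideal ` I" "B' \<in> ideal ` I"
    then obtain a a' b b' where *: "a \<in> I" "a' \<in> I" "b \<in> I" "b' \<in> I"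
        "A = ideal a" "A' = ideal a'" "B = ideal b" "B' = ideal b'" by auto
    show "D (A \<union> B) (A' \<union> B') \<le> K * (D A A' + D B B') + s"
      using * lip[of a b q a' b' q] self[of q] q I_carrier join_in_I
      by (simp add: D_def \<iota> join_def flip: ideal_join)
    show "D (A \<inter> B) (A' \<inter> B') \<le> K * (D A A' + D B B') + s"
      using * lip[of p a b p a' b'] self[of p] p I_carrier meet_in_I
      by (simp add: D_def \<iota> meet_def flip: ideal_meet)
  qed (use K s in auto)
  have width: "width_le d (\<Union>(ideal ` F) - ideal p)"
    unfolding width_le_def
  proof (intro allI impI)
    fix T assume T: "T \<subseteq> \<Union>(ideal ` F) - ideal p" and "antichain T"
    have TJ: "T \<subseteq> J" using T by (auto simp: ideal_def)
    show "card T \<le> d"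
    proof (rule incomparable_card[OF rank TJ], rule ccontr)
      fix i j assume ij: "i \<in> T" "j \<in> T" "le i j" "i \<noteq> j"
      then have "ideal i \<subseteq> ideal j" using TJ J_in_I by (subst ideal_subset_iff) auto
      then show False using \<open>antichain T\<close> ij by (auto simp: antichain_def)
    qed
  qed
  have "coverable D (ideal ` F) (cover_number M d) (cover_radius K d * s)"
  proof (rule coverable_of_width[OF _ _ _ width])
    fix j assume "j \<in> \<Union>(ideal ` F)"
    then obtain f where f: "f \<in> F" "j \<in> ideal f" by auto
    then obtain a where a: "\<forall>t\<le>M. a t \<in> I" "a 0 = p" "a M = f"
      "\<forall>t<M. dd (a t) (a (Suc t)) \<le> s" using paths by blast
    have "step_path M (\<lambda>t. ideal (a t))"
      using a by (auto simp: step_path_def D_def \<iota> ideal_p)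
    then show "\<exists>a. step_path M a \<and> j \<in> a M" using a f by blast
  qed (use p_in_I F ideal_p in auto)
  then obtain g where g: "g ` ideal ` F \<subseteq> {..<cover_number M d}"
    "\<forall>x\<in>ideal ` F. \<forall>y\<in>ideal ` F. g x = g y \<longrightarrow> D x y \<le> cover_radius K d * s"
    by (auto simp: coverable_def)
  have "dd x y \<le> cover_radius K d * s" if "x \<in> F" "y \<in> F" "g (ideal x) = g (ideal y)" for x y
    using g(2) that F \<iota> by (auto simp: D_def subset_iff)
  then show ?thesis unfolding coverable_def using g(1)
    by (intro exI[of _ "g \<circ> ideal"]) (auto simp: image_subset_iff)
qed

end

text \<open>Elements are joined one at a time and the result is compared with
  \<open>join p p = p\<close>. The displacement obeys the recursion of \<open>join_radius\<close>,
  now with unit \<open>r + s\<close>.\<close>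

lemma (in median_interval_lattice) join_bound:
  fixes dd :: "'a \<Rightarrow> 'a \<Rightarrow> real"
  assumes K: "0 \<le> K" and s: "0 \<le> s" and r: "0 \<le> r"
    and self: "\<And>a. a \<in> \<Phi> \<Longrightarrow> dd a a = 0"
    and lip: "\<And>a b c a' b' c'. a \<in> \<Phi> \<Longrightarrow> b \<in> \<Phi> \<Longrightarrow> c \<in> \<Phi> \<Longrightarrow> a' \<in> \<Phi> \<Longrightarrow> b' \<in> \<Phi> \<Longrightarrow> c' \<in> \<Phi>
      \<Longrightarrow> dd (\<mu> a b c) (\<mu> a' b' c') \<le> K * (dd a a' + dd b b' + dd c c') + s"
    and Q: "finite Q" "Q \<subseteq> I" "\<And>x. x \<in> Q \<Longrightarrow> dd p x \<le> r"
  shows "\<exists>h\<in>I. (\<forall>x\<in>Q. le x h) \<and> dd p h \<le> join_radius K 1 (card Q) * (r + s)"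
  using Q
proof (induction Q rule: finite_induct)
  case empty
  then show ?case using p_in_I self[OF p] by (intro bexI[of _ p]) auto
next
  case (insert x Q)
  then obtain h where h: "h \<in> I" "\<forall>x\<in>Q. le x h" "dd p h \<le> join_radius K 1 (card Q) * (r + s)"
    by auto
  have x: "x \<in> I" "dd p x \<le> r" using insert by auto
  have "dd (join p p) (join x h) \<le> K * (dd p x + dd p h + dd q q) + s"
    unfolding join_def using x h p q I_carrier by (intro lip) auto
  also have "\<dots> \<le> K * (r + join_radius K 1 (card Q) * (r + s) + 0) + s"
    using x h self[OF q] K by (intro add_mono mult_left_mono) auto
  also have "\<dots> \<le> join_radius K 1 (Suc (card Q)) * (r + s)"
  proof -
    have "0 \<le> K * s" using K s by simp
    then show ?thesis using r by (simp add: algebra_simps)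
  qed
  finally have "dd p (join x h) \<le> join_radius K 1 (card (insert x Q)) * (r + s)"
    using insert(1,2) join_p[OF p_in_I] by simp
  moreover have "le z (join x h)" if "z \<in> insert x Q" for z
  proof (cases "z = x")
    case False
    then have "z \<in> I" "le z h" using that insert.prems(1) h(2) by auto
    then show ?thesis using le_trans[of z h "join x h"] le_join x h join_in_I by simp
  qed (use le_join x h in simp)
  ultimately show ?case using join_in_I x h by (intro bexI[of _ "join x h"]) auto
qed

section \<open>Total boundedness of coarse intervals\<close>

locale coarse_median =
  fixes X :: "'a::metric_space set" and \<mu> :: "'a \<Rightarrow> 'a \<Rightarrow> 'a \<Rightarrow> 'a"
    and K :: real and H :: "nat \<Rightarrow> real" and d :: nat
  assumes closed: "a \<in> X \<Longrightarrow> b \<in> X \<Longrightarrow> c \<in> X \<Longrightarrow> \<mu> a b c \<in> X"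
    and K_ge_1: "1 \<le> K" and H_nonneg: "0 \<le> H n"
    and C1: "coarse_median_C1 X \<mu> K (H 0)"
    and C2: "A \<subseteq> X \<Longrightarrow> finite A \<Longrightarrow> 1 \<le> card A \<Longrightarrow> card A \<le> n
      \<Longrightarrow> \<exists>P :: nat set. \<exists>m. median_approximation X \<mu> A (H n) P m \<and> median_rank_le P m d"
begin

lemma lipschitz:
  "a \<in> X \<Longrightarrow> b \<in> X \<Longrightarrow> c \<in> X \<Longrightarrow> a' \<in> X \<Longrightarrow> b' \<in> X \<Longrightarrow> c' \<in> X
    \<Longrightarrow> dist (\<mu> a b c) (\<mu> a' b' c') \<le> K * (dist a a' + dist b b' + dist c c') + H 0"
  using C1 by (auto simp: coarse_median_C1_def)

end

locale coarse_median_approximation = coarse_median X \<mu> K H d + median_algebra P m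
  for X :: "'a::metric_space set" and \<mu> K H d and P :: "nat set" and m +
  fixes A :: "'a set" and E :: real and \<pi> :: "'a \<Rightarrow> nat" and \<sigma> :: "nat \<Rightarrow> 'a"
  assumes finite_P: "finite P" and rank: "median_rank_le P m d" and E_nonneg: "0 \<le> E"
    and \<pi>: "a \<in> A \<Longrightarrow> \<pi> a \<in> P" and \<sigma>: "x \<in> P \<Longrightarrow> \<sigma> x \<in> X"
    and \<sigma>_median: "x \<in> P \<Longrightarrow> y \<in> P \<Longrightarrow> z \<in> P \<Longrightarrow> dist (\<sigma> (m x y z)) (\<mu> (\<sigma> x) (\<sigma> y) (\<sigma> z)) \<le> E"
    and \<sigma>_\<pi>: "a \<in> A \<Longrightarrow> dist a (\<sigma> (\<pi> a)) \<le> E"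
begin

lemma \<sigma>_median_near:
  assumes P: "x \<in> P" "y \<in> P" "z \<in> P" and X: "a \<in> X" "b \<in> X" "c \<in> X"
    and d: "dist (\<sigma> x) a \<le> \<alpha>" "dist (\<sigma> y) b \<le> \<beta>" "dist (\<sigma> z) c \<le> \<gamma>"
  shows "dist (\<sigma> (m x y z)) (\<mu> a b c) \<le> E + K * (\<alpha> + \<beta> + \<gamma>) + H 0"
proof -
  have "dist (\<sigma> (m x y z)) (\<mu> a b c)
      \<le> dist (\<sigma> (m x y z)) (\<mu> (\<sigma> x) (\<sigma> y) (\<sigma> z)) + dist (\<mu> (\<sigma> x) (\<sigma> y) (\<sigma> z)) (\<mu> a b c)"
    by (rule dist_triangle)
  also have "\<dots> \<le> E + (K * (dist (\<sigma> x) a + dist (\<sigma> y) b + dist (\<sigma> z) c) + H 0)"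
    using P X \<sigma> by (intro add_mono \<sigma>_median lipschitz) auto
  also have "K * (dist (\<sigma> x) a + dist (\<sigma> y) b + dist (\<sigma> z) c) \<le> K * (\<alpha> + \<beta> + \<gamma>)"
    using d K_ge_1 by (intro mult_left_mono) auto
  finally show ?thesis by simp
qed

text \<open>This makes the pull-back of the metric along \<sigma> a pseudometric on \<open>P\<close>
  to which the results on finite algebras apply. Each of the two passages between \<open>m\<close>
  and \<mu> costs one \<open>E\<close>.\<close>

lemma \<sigma>_lipschitz:
  assumes P: "x \<in> P" "y \<in> P" "z \<in> P" "x' \<in> P" "y' \<in> P" "z' \<in> P"
  shows "dist (\<sigma> (m x y z)) (\<sigma> (m x' y' z'))
    \<le> K * (dist (\<sigma> x) (\<sigma> x') + dist (\<sigma> y) (\<sigma> y') + dist (\<sigma> z) (\<sigma> z')) + (H 0 + 2 * E)"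
proof -
  have "dist (\<sigma> (m x y z)) (\<sigma> (m x' y' z')) \<le> dist (\<sigma> (m x y z)) (\<mu> (\<sigma> x') (\<sigma> y') (\<sigma> z'))
      + dist (\<sigma> (m x' y' z')) (\<mu> (\<sigma> x') (\<sigma> y') (\<sigma> z'))"
    by (rule dist_triangle2)
  also have "\<dots> \<le> (E + K * (dist (\<sigma> x) (\<sigma> x') + dist (\<sigma> y) (\<sigma> y') + dist (\<sigma> z) (\<sigma> z')) + H 0) + E"
    using P \<sigma> by (intro add_mono \<sigma>_median_near \<sigma>_median) auto
  finally show ?thesis by simp
qed

lemma \<sigma>_\<pi>': "a \<in> A \<Longrightarrow> dist (\<sigma> (\<pi> a)) a \<le> E"
  using \<sigma>_\<pi> by (simp add: dist_commute)

end

lemma (in coarse_median) approximation_exists: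
  assumes "A \<subseteq> X" "finite A" "A \<noteq> {}" "card A \<le> n"
  shows "\<exists>P m \<pi> \<sigma>. coarse_median_approximation X \<mu> K H d P m A (H n) \<pi> \<sigma>"
proof -
  have "1 \<le> card A" using assms by (simp add: Suc_le_eq card_gt_0_iff)
  then obtain P m where P: "median_approximation X \<mu> A (H n) (P :: nat set) m" "median_rank_le P m d"
    using C2 assms by blast
  then interpret P: median_algebra P m by (simp add: median_approximation_def)
  obtain \<pi> \<sigma> where "\<pi> \<in> A \<rightarrow> P" "\<sigma> \<in> P \<rightarrow> X"
      "\<forall>x\<in>P. \<forall>y\<in>P. \<forall>z\<in>P. dist (\<sigma> (m x y z)) (\<mu> (\<sigma> x) (\<sigma> y) (\<sigma> z)) \<le> H n"
      "\<forall>a\<in>A. dist a (\<sigma> (\<pi> a)) \<le> H n"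
    using P(1) by (auto simp: median_approximation_def)
  then have "coarse_median_approximation X \<mu> K H d P m A (H n) \<pi> \<sigma>"
    using P H_nonneg by unfold_locales (auto simp: median_approximation_def Pi_iff)
  then show ?thesis by blast
qed

section \<open>Sampled quasigeodesics and separated sets in coarse intervals\<close>

locale quasigeodesic_coarse_median = coarse_median +
  fixes G\<^sub>1 G\<^sub>2 :: real
  assumes G1: "1 \<le> G\<^sub>1" and G2: "0 \<le> G\<^sub>2"
    and quasigeodesic: "x \<in> X \<Longrightarrow> y \<in> X
      \<Longrightarrow> \<exists>T\<ge>0. \<exists>g. quasigeodesic_path X G\<^sub>1 G\<^sub>2 T g \<and> g 0 = x \<and> g T = y"
begin

text \<open>The parameter length \<open>T\<close> is at most \<open>2 * r * G\<^sub>1\<close>.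
  Sampling at \<open>M\<close> equal intervals gives steps of at most
  \<open>G\<^sub>1 * T / M + G\<^sub>2\<close>, and both terms are at most
  \<open>\<delta> * r / 2\<close>.\<close>

lemma sampled_path:
  assumes X: "x \<in> X" "y \<in> X" and r: "dist x y \<le> r" "G\<^sub>2 \<le> r" "2 * G\<^sub>2 \<le> \<delta> * r"
    and M: "4 * G\<^sub>1\<^sup>2 \<le> \<delta> * real M" "0 < M"
  shows "\<exists>a. (\<forall>t\<le>M. a t \<in> X) \<and> a 0 = x \<and> a M = y \<and> (\<forall>t<M. dist (a t) (a (Suc t)) \<le> \<delta> * r)"
proof -
  obtain T g where T: "0 \<le> T" and g: "quasigeodesic_path X G\<^sub>1 G\<^sub>2 T g" "g 0 = x" "g T = y"
    using quasigeodesic X by blast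
  have "(1 / G\<^sub>1) * \<bar>0 - T\<bar> - G\<^sub>2 \<le> dist (g 0) (g T)"
    using g(1) T unfolding quasigeodesic_path_def by (meson atLeastAtMost_iff order_refl)
  then have "(1 / G\<^sub>1) * T \<le> 2 * r" using g r T by simp
  then have Tle: "T \<le> 2 * r * G\<^sub>1" using G1 by (simp add: field_simps)
  have mem: "real t * T / real M \<in> {0..T}" if "t \<le> M" for t
  proof -
    have "real t * T \<le> real M * T" using that T by (intro mult_right_mono) auto
    then show ?thesis using T M by (simp add: field_simps)
  qed
  have "dist (g (real t * T / real M)) (g (real (Suc t) * T / real M)) \<le> \<delta> * r" if t: "t < M" for t
  proof -
    have "real t * T / real M - real (Suc t) * T / real M = - (T / real M)"
      using M by (simp add: field_simps)
    then have "\<bar>real t * T / real M - real (Suc t) * T / real M\<bar> = T / real M"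
      using T M by simp
    then have "dist (g (real t * T / real M)) (g (real (Suc t) * T / real M)) \<le> G\<^sub>1 * (T / real M) + G\<^sub>2"
      using g(1) mem[of t] mem[of "Suc t"] t unfolding quasigeodesic_path_def by (metis Suc_leI less_imp_le)
    also have "G\<^sub>1 * (T / real M) \<le> \<delta> * r / 2"
    proof -
      have "0 \<le> r" using r(1) by (meson order_trans zero_le_dist)
      then have "4 * G\<^sub>1\<^sup>2 * r \<le> \<delta> * real M * r" using M by (intro mult_right_mono) auto
      moreover have "G\<^sub>1 * T \<le> G\<^sub>1 * (2 * r * G\<^sub>1)" using Tle G1 by (intro mult_left_mono) auto
      ultimately have "G\<^sub>1 * T \<le> \<delta> * r / 2 * real M" by (simp add: power2_eq_square algebra_simps)
      then show ?thesis using M by (simp add: field_simps)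
    qed
    finally show ?thesis using r(3) by simp
  qed
  moreover have "g (real t * T / real M) \<in> X" if "t \<le> M" for t
    using g(1) mem[OF that] unfolding quasigeodesic_path_def by auto
  ultimately show ?thesis using g M
    by (intro exI[of _ "\<lambda>t. g (real t * T / real M)"]) auto
qed

text \<open>The number of sample points, hence the
  approximation error \<open>E\<close>, depends only on \<open>\<epsilon>\<close>, so that for large \<open>r\<close> it is negligible.\<close>

lemma separated_bounded:
  assumes \<epsilon>: "0 < \<epsilon>"
  shows "\<exists>N r\<^sub>0. \<forall>r\<ge>r\<^sub>0. \<forall>y\<in>X. \<forall>b\<in>X. \<forall>F. finite F \<longrightarrow> F \<subseteq> X \<longrightarrow>
    (\<forall>f\<in>F. dist y f \<le> r \<and> dist f (\<mu> y b f) \<le> \<epsilon> * r / 8) \<longrightarrow>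
    (\<forall>f\<in>F. \<forall>f'\<in>F. f \<noteq> f' \<longrightarrow> \<epsilon> * r < dist f f') \<longrightarrow> card F \<le> N"
proof -
  define C where "C = cover_radius K d"
  \<comment> \<open>Chosen so that \<open>C * s \<le> \<epsilon> * r / 4\<close> for
    \<open>s = 2 * K * \<delta> * r\<close>.\<close>
  define \<delta> where "\<delta> = \<epsilon> / (C + 1) / (8 * K)"
  define M where "M = nat \<lceil>4 * G\<^sub>1\<^sup>2 / \<delta>\<rceil> + 1"
  define N where "N = cover_number M d"
  \<comment> \<open>Room for \<open>y\<close>, \<open>b\<close> and the \<open>M + 1\<close> sample
    points on each of \<open>N + 1\<close> paths.\<close>
  define n where "n = 2 + (N + 1) * (M + 1)"
  define E where "E = H n"
  define E' where "E' = H 0 + 2 * E"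
  define e where "e = E + K * (E + E + E) + H 0"
  have C0: "0 \<le> C" using K_ge_1 by (simp add: C_def cover_radius_nonneg)
  have \<delta>0: "0 < \<delta>" using \<epsilon> C0 K_ge_1 by (simp add: \<delta>_def)
  have M: "4 * G\<^sub>1\<^sup>2 \<le> \<delta> * real M" "0 < M"
  proof -
    have "4 * G\<^sub>1\<^sup>2 / \<delta> \<le> real M" unfolding M_def by linarith
    then show "4 * G\<^sub>1\<^sup>2 \<le> \<delta> * real M" using \<delta>0 by (simp add: field_simps)
  qed (simp add: M_def)
  have E0: "0 \<le> E" "0 \<le> E'" "0 \<le> e" using H_nonneg K_ge_1 by (auto simp: E_def E'_def e_def)
  \<comment> \<open>Beyond this scale \<open>G\<^sub>2\<close> and the approximation errors are
    small against \<open>\<delta> * r\<close> and \<open>\<epsilon> * r\<close>.\<close>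
  define r\<^sub>0 where "r\<^sub>0 = Max {1, G\<^sub>2, 2 * G\<^sub>2 / \<delta>, (2 * K * E + E') / (K * \<delta>), 4 * e / \<epsilon>}"
  have "card F \<le> N" if r: "r\<^sub>0 \<le> r" and y: "y \<in> X" and b: "b \<in> X" and F: "finite F" "F \<subseteq> X"
      "\<forall>f\<in>F. dist y f \<le> r \<and> dist f (\<mu> y b f) \<le> \<epsilon> * r / 8"
      "\<forall>f\<in>F. \<forall>f'\<in>F. f \<noteq> f' \<longrightarrow> \<epsilon> * r < dist f f'" for r y b F
  proof (rule ccontr)
    assume "\<not> card F \<le> N"
    then have "N + 1 \<le> card F" by simp
    then obtain F' where F': "F' \<subseteq> F" "card F' = N + 1" "finite F'"
      by (rule obtain_subset_with_card_n)
    have r_ge: "1 \<le> r" "G\<^sub>2 \<le> r" "2 * G\<^sub>2 / \<delta> \<le> r" "(2 * K * E + E') / (K * \<delta>) \<le> r" "4 * e / \<epsilon> \<le> r"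
      using r by (simp_all add: r\<^sub>0_def)
    then have r': "2 * G\<^sub>2 \<le> \<delta> * r" "2 * K * E + E' \<le> K * \<delta> * r" "4 * e \<le> \<epsilon> * r"
      using \<delta>0 \<epsilon> K_ge_1 by (simp_all add: field_simps)
    have "\<exists>a. (\<forall>t\<le>M. a t \<in> X) \<and> a 0 = y \<and> a M = f \<and> (\<forall>t<M. dist (a t) (a (Suc t)) \<le> \<delta> * r)"
      if "f \<in> F'" for f
      using that F F' y r_ge r' M by (intro sampled_path) auto
    then obtain a where a: "\<And>f t. f \<in> F' \<Longrightarrow> t \<le> M \<Longrightarrow> a f t \<in> X" "\<And>f. f \<in> F' \<Longrightarrow> a f 0 = y"
        "\<And>f. f \<in> F' \<Longrightarrow> a f M = f"
        "\<And>f t. f \<in> F' \<Longrightarrow> t < M \<Longrightarrow> dist (a f t) (a f (Suc t)) \<le> \<delta> * r"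
      by metis
    define A where "A = {y, b} \<union> (\<lambda>(f, t). a f t) ` (F' \<times> {..M})"
    have A: "A \<subseteq> X" "finite A" "A \<noteq> {}" using a y b F' by (auto simp: A_def)
    have "card A \<le> card {y, b} + card (F' \<times> {..M})"
      unfolding A_def using F' by (intro order_trans[OF card_Un_le] add_mono card_image_le) auto
    also have "\<dots> \<le> n" using F' by (auto simp: n_def card_cartesian_product card_insert_if)
    finally have "card A \<le> n" .
    then obtain P m \<pi> \<sigma> where "coarse_median_approximation X \<mu> K H d P m A E \<pi> \<sigma>"
      using approximation_exists[OF A] unfolding E_def by blast
    then interpret P: coarse_median_approximation X \<mu> K H d P m A E \<pi> \<sigma> .
    have aA: "a f t \<in> A" if "f \<in> F'" "t \<le> M" for f t
      using that by (auto simp: A_def)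
    interpret L: median_interval_lattice P m "\<pi> y" "\<pi> b"
      using P.\<pi> P.finite_P by unfold_locales (auto simp: A_def)
    have py: "\<pi> y \<in> P" and pb: "\<pi> b \<in> P" using L.p L.q .
    have ya: "y \<in> A" "b \<in> A" by (auto simp: A_def)
    have pa: "\<pi> (a f t) \<in> P" if "f \<in> F'" "t \<le> M" for f t using aA[OF that] P.\<pi> by blast
    have fA: "f \<in> A" if "f \<in> F'" for f using aA[of f M] a(3)[OF that] that by simp
    define \<rho> where "\<rho> f = m (\<pi> y) (\<pi> b) (\<pi> f)" for f
    \<comment> \<open>Large enough for both roles of \<open>s\<close>: the additive error of the
      median, and the step length of the sampled paths after projection by \<rho>.\<close>
    define s where "s = 2 * K * \<delta> * r"
    have s: "E' \<le> s" "K * (E + \<delta> * r + E) + E' \<le> s"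
    proof -
      show "K * (E + \<delta> * r + E) + E' \<le> s" using r'(2) by (simp add: s_def algebra_simps)
      have "0 \<le> K * (E + \<delta> * r + E)" using K_ge_1 E0 \<delta>0 r_ge by simp
      then show "E' \<le> s" using \<open>K * (E + \<delta> * r + E) + E' \<le> s\<close> by linarith
    qed
    have cov: "coverable (\<lambda>x y. dist (\<sigma> x) (\<sigma> y)) (\<rho> ` F') N (C * s)"
      unfolding N_def C_def
    proof (rule L.interval_coverable[OF P.rank])
      show "0 \<le> K" "0 \<le> s" using K_ge_1 s E0 by auto
      show "dist (\<sigma> x) (\<sigma> x) = 0" for x by simp
      show "dist (\<sigma> x) (\<sigma> y) = dist (\<sigma> y) (\<sigma> x)" for x y by (rule dist_commute)
      show "dist (\<sigma> x) (\<sigma> z) \<le> dist (\<sigma> x) (\<sigma> y) + dist (\<sigma> y) (\<sigma> z)" for x y z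
        by (rule dist_triangle)
      show "dist (\<sigma> (m x y z)) (\<sigma> (m x' y' z'))
        \<le> K * (dist (\<sigma> x) (\<sigma> x') + dist (\<sigma> y) (\<sigma> y') + dist (\<sigma> z) (\<sigma> z')) + s"
        if "x \<in> P" "y \<in> P" "z \<in> P" "x' \<in> P" "y' \<in> P" "z' \<in> P" for x y z x' y' z'
        using P.\<sigma>_lipschitz[OF that] s(1) by (simp add: E'_def)
      show "\<rho> ` F' \<subseteq> L.I"
        using L.gate_in_I P.\<pi> fA by (auto simp: \<rho>_def)
      fix f' assume "f' \<in> \<rho> ` F'"
      then obtain f where f: "f \<in> F'" "f' = \<rho> f" by auto
      show "\<exists>c. (\<forall>t\<le>M. c t \<in> L.I) \<and> c 0 = \<pi> y \<and> c M = f' \<and>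
        (\<forall>t<M. dist (\<sigma> (c t)) (\<sigma> (c (Suc t))) \<le> s)"
      proof (intro exI[of _ "\<lambda>t. \<rho> (a f t)"] conjI allI impI)
        show "\<rho> (a f t) \<in> L.I" if "t \<le> M" for t
          using L.gate_in_I pa f that by (auto simp: \<rho>_def)
        show "\<rho> (a f 0) = \<pi> y" using a(2) f py pb by (simp add: \<rho>_def P.M2_outer)
        show "\<rho> (a f M) = f'" using a(3) f by simp
        fix t assume t: "t < M"
        have "dist (\<sigma> (\<pi> (a f t))) (\<sigma> (\<pi> (a f (Suc t)))) \<le> dist (\<sigma> (\<pi> (a f t))) (a f t)
            + dist (a f t) (a f (Suc t)) + dist (a f (Suc t)) (\<sigma> (\<pi> (a f (Suc t))))"
          by (meson add_mono dist_triangle order_refl order_trans)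
        also have "\<dots> \<le> E + \<delta> * r + E"
          using t f aA by (intro add_mono P.\<sigma>_\<pi> P.\<sigma>_\<pi>' a(4)) auto
        finally have *: "dist (\<sigma> (\<pi> (a f t))) (\<sigma> (\<pi> (a f (Suc t)))) \<le> E + \<delta> * r + E" .
        have "dist (\<sigma> (\<rho> (a f t))) (\<sigma> (\<rho> (a f (Suc t))))
            \<le> K * dist (\<sigma> (\<pi> (a f t))) (\<sigma> (\<pi> (a f (Suc t)))) + E'"
          using P.\<sigma>_lipschitz[OF py pb pa py pb pa, of f t f "Suc t"] f t
          by (simp add: \<rho>_def E'_def)
        also have "\<dots> \<le> K * (E + \<delta> * r + E) + E'"
          using * K_ge_1 by (intro add_mono mult_left_mono) auto
        also have "\<dots> \<le> s" by (rule s)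
        finally show "dist (\<sigma> (\<rho> (a f t))) (\<sigma> (\<rho> (a f (Suc t)))) \<le> s" .
      qed
    qed
    obtain f f' where f: "f \<in> F'" "f' \<in> F'" "f \<noteq> f'" "dist (\<sigma> (\<rho> f)) (\<sigma> (\<rho> f')) \<le> C * s"
      using coverable_pigeonhole[OF cov F'(3)] F'(2) by auto
    \<comment> \<open>Points of \<open>F\<close> already lie coarsely between \<open>y\<close> and
      \<open>b\<close>, so projecting moves them little. Two projections in one piece thus
      contradict the separation of \<open>F\<close>.\<close>
    have near: "dist (\<sigma> (\<rho> x)) x \<le> e + \<epsilon> * r / 8" if "x \<in> F'" for x
    proof -
      have "dist (\<sigma> (\<rho> x)) (\<mu> y b x) \<le> e" unfolding \<rho>_def e_def
        using that fA P.\<pi> F F' y b ya by (intro P.\<sigma>_median_near P.\<sigma>_\<pi>') auto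
      moreover have "dist x (\<mu> y b x) \<le> \<epsilon> * r / 8" using F F' that by auto
      ultimately show ?thesis using dist_triangle2[of "\<sigma> (\<rho> x)" x "\<mu> y b x"] by simp
    qed
    have "C * s \<le> \<epsilon> * r / 4"
    proof -
      have "2 * K * (x / (8 * K)) = x / 4" for x using K_ge_1 by simp
      then have "2 * K * \<delta> = \<epsilon> / (C + 1) / 4" unfolding \<delta>_def .
      then have "C * s = (C / (C + 1)) * (\<epsilon> * r / 4)" by (simp add: s_def)
      also have "\<dots> \<le> 1 * (\<epsilon> * r / 4)"
        using C0 \<epsilon> r_ge by (intro mult_right_mono) auto
      finally show ?thesis by simp
    qed
    then have "dist f f' \<le> (e + \<epsilon> * r / 8) + \<epsilon> * r / 4 + (e + \<epsilon> * r / 8)"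
      using dist_triangle[of f f' "\<sigma> (\<rho> f)"] dist_triangle[of "\<sigma> (\<rho> f)" f' "\<sigma> (\<rho> f')"]
        near[OF f(1)] near[OF f(2)] f(4) by (simp add: dist_commute)
    then have "dist f f' \<le> \<epsilon> * r" using r'(3) by simp
    then show False using F(4) F'(1) f by (meson not_less subsetD)
  qed
  then show ?thesis by blast
qed

text \<open>A maximal separated subset serves as the net; its size is bounded by
  \<open>separated_bounded\<close>, independently of \<open>r\<close>, \<open>y\<close> and
  \<open>b\<close>.\<close>

lemma interval_net:
  assumes \<epsilon>: "0 < \<epsilon>"
  shows "\<exists>N r\<^sub>0. 0 < r\<^sub>0 \<and> (\<forall>r\<ge>r\<^sub>0. \<forall>y\<in>X. \<forall>b\<in>X.
    \<exists>F\<subseteq>{f \<in> X. dist y f \<le> r \<and> dist f (\<mu> y b f) \<le> \<epsilon> * r / 8}. finite F \<and> card F \<le> N \<and>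
      (\<forall>f\<in>X. dist y f \<le> r \<longrightarrow> dist f (\<mu> y b f) \<le> \<epsilon> * r / 8 \<longrightarrow> (\<exists>z\<in>F. dist f z \<le> \<epsilon> * r)))"
proof -
  obtain N r\<^sub>0 where N: "\<forall>r\<ge>r\<^sub>0. \<forall>y\<in>X. \<forall>b\<in>X. \<forall>F. finite F \<longrightarrow> F \<subseteq> X \<longrightarrow>
    (\<forall>f\<in>F. dist y f \<le> r \<and> dist f (\<mu> y b f) \<le> \<epsilon> * r / 8) \<longrightarrow>
    (\<forall>f\<in>F. \<forall>f'\<in>F. f \<noteq> f' \<longrightarrow> \<epsilon> * r < dist f f') \<longrightarrow> card F \<le> N"
    using separated_bounded[OF \<epsilon>] by blast
  show ?thesis
  proof (intro exI[of _ N] exI[of _ "max 1 r\<^sub>0"] conjI allI impI ballI)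
    fix r y b assume r: "max 1 r\<^sub>0 \<le> r" and yb: "y \<in> X" "b \<in> X"
    let ?Q = "{f \<in> X. dist y f \<le> r \<and> dist f (\<mu> y b f) \<le> \<epsilon> * r / 8}"
    have "\<exists>F\<subseteq>?Q. finite F \<and> card F \<le> N \<and> (\<forall>z\<in>?Q. \<exists>f\<in>F. dist z f \<le> \<epsilon> * r)"
    proof (rule finite_net)
      fix T assume "finite T" "T \<subseteq> ?Q" "\<And>x y. x \<in> T \<Longrightarrow> y \<in> T \<Longrightarrow> x \<noteq> y \<Longrightarrow> \<epsilon> * r < dist x y"
      moreover have "r\<^sub>0 \<le> r" using r by simp
      ultimately show "card T \<le> N" using N[rule_format, OF _ yb, of r T] by auto
    qed (use \<epsilon> r in \<open>auto simp: dist_commute\<close>)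
    then show "\<exists>F\<subseteq>?Q. finite F \<and> card F \<le> N \<and>
      (\<forall>f\<in>X. dist y f \<le> r \<longrightarrow> dist f (\<mu> y b f) \<le> \<epsilon> * r / 8 \<longrightarrow> (\<exists>z\<in>F. dist f z \<le> \<epsilon> * r))"
      by (elim exE conjE) (intro exI conjI, assumption+, auto)
  qed simp
qed

end

section \<open>Deep points\<close>

context coarse_median
begin

text \<open>In a median algebra the median of \<open>x\<close>, \<open>y\<close>, \<open>b\<close>
  is fixed by the projection to \<open>[y, b]\<close>, and it equals \<open>y\<close> when
  \<open>x = y\<close>. An approximation of three points carries both facts over.\<close>

lemma median_in_interval:
  "\<exists>\<kappa>\<ge>0. \<forall>x\<in>X. \<forall>y\<in>X. \<forall>b\<in>X. dist (\<mu> x y b) (\<mu> y b (\<mu> x y b)) \<le> \<kappa> \<and>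
    dist y (\<mu> x y b) \<le> K * dist x y + \<kappa>"
proof -
  define E where "E = H 3"
  define e where "e = E + K * (E + E + E) + H 0"
  define \<kappa> where "\<kappa> = (e + (E + K * (E + E + e) + H 0)) + (E + K * (2 * E) + (H 0 + 2 * E) + e)"
  have E0: "0 \<le> E" "0 \<le> e" "0 \<le> H 0" "0 \<le> K" using H_nonneg K_ge_1 by (auto simp: E_def e_def)
  have "dist (\<mu> x y b) (\<mu> y b (\<mu> x y b)) \<le> \<kappa> \<and> dist y (\<mu> x y b) \<le> K * dist x y + \<kappa>"
    if X: "x \<in> X" "y \<in> X" "b \<in> X" for x y b
  proof -
    define A where "A = {x, y, b}"
    have "card A \<le> 3" by (auto simp: A_def card_insert_if)
    then obtain P m \<pi> \<sigma> where "coarse_median_approximation X \<mu> K H d P m A E \<pi> \<sigma>"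
      using approximation_exists[of A 3] X unfolding E_def by (auto simp: A_def)
    then interpret P: coarse_median_approximation X \<mu> K H d P m A E \<pi> \<sigma> .
    have A: "x \<in> A" "y \<in> A" "b \<in> A" by (auto simp: A_def)
    note \<pi> = A[THEN P.\<pi>]
    let ?m = "m (\<pi> x) (\<pi> y) (\<pi> b)"
    have m: "?m \<in> P" using \<pi> P.closed by simp
    have near: "dist (\<sigma> ?m) (\<mu> x y b) \<le> e"
      unfolding e_def using A X \<pi> by (intro P.\<sigma>_median_near P.\<sigma>_\<pi>') auto
    have "dist (\<sigma> (m (\<pi> y) (\<pi> b) ?m)) (\<mu> y b (\<mu> x y b)) \<le> E + K * (E + E + e) + H 0"
      using A X \<pi> m near closed by (intro P.\<sigma>_median_near P.\<sigma>_\<pi>') auto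
    moreover have "m (\<pi> y) (\<pi> b) ?m = ?m"
      using \<pi> P.M1_rotate[of "\<pi> x" "\<pi> y" "\<pi> b"] P.gate_idem by simp
    ultimately have 1: "dist (\<mu> x y b) (\<mu> y b (\<mu> x y b)) \<le> e + (E + K * (E + E + e) + H 0)"
      using near dist_triangle3[of "\<mu> x y b" "\<mu> y b (\<mu> x y b)" "\<sigma> ?m"] by simp
    have "dist (\<sigma> (m (\<pi> y) (\<pi> y) (\<pi> b))) (\<sigma> ?m)
        \<le> K * (dist (\<sigma> (\<pi> y)) (\<sigma> (\<pi> x)) + 0 + 0) + (H 0 + 2 * E)"
      using P.\<sigma>_lipschitz[OF \<pi>(2,2,3,1,2,3)] by simp
    also have "dist (\<sigma> (\<pi> y)) (\<sigma> (\<pi> x)) \<le> dist x y + 2 * E"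
      using dist_triangle[of "\<sigma> (\<pi> y)" "\<sigma> (\<pi> x)" y] dist_triangle[of y "\<sigma> (\<pi> x)" x]
        P.\<sigma>_\<pi>[OF A(1)] P.\<sigma>_\<pi>'[OF A(2)] by (simp add: dist_commute)
    finally have "dist (\<sigma> (\<pi> y)) (\<sigma> ?m) \<le> K * (dist x y + 2 * E) + (H 0 + 2 * E)"
      using K_ge_1 \<pi> by (simp add: P.M2 mult_left_mono)
    then have 2: "dist y (\<mu> x y b) \<le> E + (K * (dist x y + 2 * E) + (H 0 + 2 * E)) + e"
      using dist_triangle[of y "\<mu> x y b" "\<sigma> (\<pi> y)"] dist_triangle[of "\<sigma> (\<pi> y)" "\<mu> x y b" "\<sigma> ?m"]
        near P.\<sigma>_\<pi>[OF A(2)] by simp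
    have "0 \<le> E + K * (2 * E) + (H 0 + 2 * E) + e" "0 \<le> e + (E + K * (E + E + e) + H 0)"
      using E0 by simp_all
    then show ?thesis using 1 2 by (simp add: \<kappa>_def algebra_simps)
  qed
  moreover have "0 \<le> \<kappa>" using E0 by (simp add: \<kappa>_def)
  ultimately show ?thesis by blast
qed

text \<open>In a median algebra, \<open>h \<in> [y, b]\<close> and \<open>m = \<mu>(x, y, b) \<in> [y, h]\<close> imply \<open>h \<in> [x, b]\<close>, because
  \<open>\<mu>(x, b, h) = \<mu>(m, b, h)\<close> for all \<open>h \<in> [y, b]\<close> and \<open>\<mu>(m', b, h) = h\<close> for all \<open>m' \<in> [y, h]\<close>.\<close>

lemma interval_transfer:
  "\<exists>a>0. \<exists>c. \<forall>x\<in>X. \<forall>y\<in>X. \<forall>b\<in>X. \<forall>h\<in>X. \<forall>\<eta>. dist h (\<mu> y b h) \<le> \<eta> \<longrightarrow>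
    dist (\<mu> x y b) (\<mu> y (\<mu> x y b) h) \<le> \<eta> \<longrightarrow> dist h (\<mu> x b h) \<le> a * \<eta> + c"
proof -
  define E where "E = H 4"
  define e where "e = E + K * (E + E + E) + H 0"
  define a where "a = 1 + 2 * K + K * K"
  define c where "c = e + K * (e + E + K * (E + 2 * e) + H 0) + (H 0 + 2 * E) + E + K * (2 * E + e) + H 0"
  have "dist h (\<mu> x b h) \<le> a * \<eta> + c"
    if X: "x \<in> X" "y \<in> X" "b \<in> X" "h \<in> X" and \<eta>: "dist h (\<mu> y b h) \<le> \<eta>"
      "dist (\<mu> x y b) (\<mu> y (\<mu> x y b) h) \<le> \<eta>" for x y b h \<eta>
  proof -
    define A where "A = {x, y, b, h}"
    have "card A \<le> 4" by (auto simp: A_def card_insert_if)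
    then obtain P m \<pi> \<sigma> where "coarse_median_approximation X \<mu> K H d P m A E \<pi> \<sigma>"
      using approximation_exists[of A 4] X unfolding E_def by (auto simp: A_def)
    then interpret P: coarse_median_approximation X \<mu> K H d P m A E \<pi> \<sigma> .
    have A: "x \<in> A" "y \<in> A" "b \<in> A" "h \<in> A" by (auto simp: A_def)
    note \<pi> = A[THEN P.\<pi>]
    \<comment> \<open>Both hypotheses are made exact in \<open>P\<close>: \<open>h'\<close> is
      \<open>h\<close> projected to the interval from \<open>\<pi> y\<close> to
      \<open>\<pi> b\<close>, and \<open>m\<^sub>2\<close> is \<open>m\<^sub>1\<close> projected to
      the interval from \<open>\<pi> y\<close> to \<open>h'\<close>. By the assumptions on \<eta>
      these projections are small moves.\<close>
    define h' where "h' = m (\<pi> y) (\<pi> b) (\<pi> h)"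
    define m\<^sub>1 where "m\<^sub>1 = m (\<pi> x) (\<pi> y) (\<pi> b)"
    define m\<^sub>2 where "m\<^sub>2 = m (\<pi> y) m\<^sub>1 h'"
    have mem: "h' \<in> P" "m\<^sub>1 \<in> P" "m\<^sub>2 \<in> P" using \<pi> P.closed by (auto simp: h'_def m\<^sub>1_def m\<^sub>2_def)
    have "dist (\<sigma> h') (\<mu> y b h) \<le> e"
      unfolding e_def h'_def using A X \<pi> by (intro P.\<sigma>_median_near P.\<sigma>_\<pi>') auto
    then have h': "dist (\<sigma> h') h \<le> e + \<eta>"
      using \<eta>(1) dist_triangle2[of "\<sigma> h'" h "\<mu> y b h"] by simp
    have m1: "dist (\<sigma> m\<^sub>1) (\<mu> x y b) \<le> e"
      unfolding e_def m\<^sub>1_def using A X \<pi> by (intro P.\<sigma>_median_near P.\<sigma>_\<pi>') auto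
    have "dist (\<sigma> m\<^sub>2) (\<mu> y (\<mu> x y b) h) \<le> E + K * (E + e + (e + \<eta>)) + H 0"
      unfolding m\<^sub>2_def using A X \<pi> mem m1 h' closed by (intro P.\<sigma>_median_near P.\<sigma>_\<pi>') auto
    then have m12: "dist (\<sigma> m\<^sub>1) (\<sigma> m\<^sub>2) \<le> e + \<eta> + (E + K * (E + e + (e + \<eta>)) + H 0)"
      using m1 \<eta>(2) dist_triangle[of "\<sigma> m\<^sub>1" "\<sigma> m\<^sub>2" "\<mu> x y b"]
        dist_triangle2[of "\<mu> x y b" "\<sigma> m\<^sub>2" "\<mu> y (\<mu> x y b) h"] by simp
    have byh: "m (\<pi> b) h' (\<pi> y) = h'"
    proof -
      have "m (\<pi> b) h' (\<pi> y) = m (\<pi> y) (\<pi> b) h'" using \<pi> mem P.M1_rotate by metis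
      then show ?thesis using \<pi> by (simp add: h'_def P.gate_idem)
    qed
    \<comment> \<open>The projection \<open>m (\<pi> b) h'\<close> sends both \<open>\<pi> y\<close>
      and \<open>h'\<close> to \<open>h'\<close>, hence also the point \<open>m\<^sub>2\<close>
      between them.\<close>
    have "m m\<^sub>2 (\<pi> b) h' = m (\<pi> b) h' (m (\<pi> y) m\<^sub>1 h')"
      using \<pi> mem P.M1_rotate[of m\<^sub>2 "\<pi> b" h'] by (simp add: m\<^sub>2_def)
    also have "\<dots> = m (m (\<pi> b) h' (\<pi> y)) (m (\<pi> b) h' m\<^sub>1) (m (\<pi> b) h' h')"
      using \<pi> mem by (intro P.gate_hom) auto
    also have "\<dots> = h'" using \<pi> mem by (simp add: byh P.M2_last P.M2_outer P.closed)
    finally have m2: "m m\<^sub>2 (\<pi> b) h' = h'" .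
    \<comment> \<open>The same projection sends \<open>\<pi> y\<close> to \<open>h'\<close> and
      fixes \<open>\<pi> b\<close>, so \<open>m\<^sub>1\<close> and \<open>\<pi> x\<close> have the
      same image.\<close>
    have "m m\<^sub>1 (\<pi> b) h' = m (\<pi> b) h' (m (\<pi> x) (\<pi> y) (\<pi> b))"
      using \<pi> mem P.M1_rotate[of m\<^sub>1 "\<pi> b" h'] by (simp add: m\<^sub>1_def)
    also have "\<dots> = m (m (\<pi> b) h' (\<pi> x)) (m (\<pi> b) h' (\<pi> y)) (m (\<pi> b) h' (\<pi> b))"
      using \<pi> mem by (intro P.gate_hom) auto
    also have "\<dots> = m (m (\<pi> b) h' (\<pi> x)) h' (\<pi> b)" using \<pi> mem by (simp add: byh P.M2_outer)
    also have "\<dots> = m (\<pi> b) h' (m (\<pi> b) h' (\<pi> x))"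
      using \<pi> mem P.closed P.M1_rotate P.M1_swap by metis
    also have "\<dots> = m (\<pi> x) (\<pi> b) h'" using \<pi> mem P.gate_idem P.M1_rotate by metis
    finally have m1': "m m\<^sub>1 (\<pi> b) h' = m (\<pi> x) (\<pi> b) h'" .
    have "dist (\<sigma> (m (\<pi> x) (\<pi> b) h')) (\<sigma> h') \<le> K * dist (\<sigma> m\<^sub>1) (\<sigma> m\<^sub>2) + (H 0 + 2 * E)"
      using P.\<sigma>_lipschitz[of m\<^sub>1 "\<pi> b" h' m\<^sub>2 "\<pi> b" h'] \<pi> mem by (simp add: m2 m1')
    also have "\<dots> \<le> K * (e + \<eta> + (E + K * (E + e + (e + \<eta>)) + H 0)) + (H 0 + 2 * E)"
      using m12 K_ge_1 by (intro add_mono mult_left_mono) auto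
    finally have "dist (\<sigma> (m (\<pi> x) (\<pi> b) h')) (\<sigma> h')
      \<le> K * (e + \<eta> + (E + K * (E + e + (e + \<eta>)) + H 0)) + (H 0 + 2 * E)" .
    moreover have "dist (\<sigma> (m (\<pi> x) (\<pi> b) h')) (\<mu> x b h) \<le> E + K * (E + E + (e + \<eta>)) + H 0"
      using A X \<pi> mem h' by (intro P.\<sigma>_median_near P.\<sigma>_\<pi>') auto
    ultimately have "dist h (\<mu> x b h) \<le> (e + \<eta>) + (K * (e + \<eta> + (E + K * (E + e + (e + \<eta>)) + H 0))
        + (H 0 + 2 * E)) + (E + K * (E + E + (e + \<eta>)) + H 0)"
      using h' dist_triangle3[of h "\<mu> x b h" "\<sigma> h'"]
        dist_triangle3[of "\<sigma> h'" "\<mu> x b h" "\<sigma> (m (\<pi> x) (\<pi> b) h')"] by simp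
    also have "\<dots> = a * \<eta> + c" by (simp add: a_def c_def algebra_simps)
    finally show ?thesis .
  qed
  moreover have "0 < a" using K_ge_1 by (simp add: a_def add_pos_nonneg)
  ultimately show ?thesis by blast
qed

end

context quasigeodesic_coarse_median
begin

text \<open>\<open>h\<close> is the join, in an approximating algebra, of the projections of a net
  of the coarse interval near \<open>y\<close>. Every \<open>z\<close> in question is close to a net
  point, whose projection lies below \<open>h\<close>. The net has at most \<open>N\<close> points
  at every scale, so \<open>h\<close> is at linear distance.\<close>

lemma deep_point:
  assumes \<epsilon>: "0 < \<epsilon>" and \<kappa>: "0 \<le> \<kappa>"
  shows "\<exists>C\<ge>0. \<exists>r\<^sub>0. \<forall>r\<ge>r\<^sub>0. \<forall>y\<in>X. \<forall>b\<in>X. \<exists>h\<in>X. dist y h \<le> C * r \<and> dist h (\<mu> y b h) \<le> \<epsilon> * r \<and>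
    (\<forall>z\<in>X. dist y z \<le> r \<longrightarrow> dist z (\<mu> y b z) \<le> \<kappa> \<longrightarrow> dist z (\<mu> y z h) \<le> \<epsilon> * r)"
proof -
  \<comment> \<open>A point \<open>z\<close> is within
    \<open>(9 / 8) * \<epsilon>\<^sub>1 * r\<close> of the projection of a net point, up to a
    constant. The Lipschitz bound brings in the factor \<open>1 + K\<close>, which leaves
    \<open>(9 / 32) * \<epsilon> * r\<close>.\<close>
  define \<epsilon>\<^sub>1 where "\<epsilon>\<^sub>1 = (\<epsilon> / 4) / (1 + K)"
  have "1 + K \<noteq> 0" using K_ge_1 by simp
  then have \<epsilon>1: "0 < \<epsilon>\<^sub>1" "(1 + K) * \<epsilon>\<^sub>1 = \<epsilon> / 4"
    using \<epsilon> K_ge_1 nonzero_mult_div_cancel_left[of "1 + K" "\<epsilon> / 4"]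
    by (simp_all only: \<epsilon>\<^sub>1_def times_divide_eq_right) auto
  obtain N r\<^sub>1 where r1: "0 < r\<^sub>1" and net: "\<forall>r\<ge>r\<^sub>1. \<forall>y\<in>X. \<forall>b\<in>X.
    \<exists>F\<subseteq>{f \<in> X. dist y f \<le> r \<and> dist f (\<mu> y b f) \<le> \<epsilon>\<^sub>1 * r / 8}. finite F \<and> card F \<le> N \<and>
      (\<forall>f\<in>X. dist y f \<le> r \<longrightarrow> dist f (\<mu> y b f) \<le> \<epsilon>\<^sub>1 * r / 8 \<longrightarrow> (\<exists>z\<in>F. dist f z \<le> \<epsilon>\<^sub>1 * r))"
    using interval_net[OF \<epsilon>1(1)] by blast
  define n where "n = 2 + N"
  define E where "E = H n"
  define E' where "E' = H 0 + 2 * E"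
  define e where "e = E + K * (E + E + E) + H 0"
  define c where "c = (1 + K) * e + E + K * E + H 0"
  define R where "R = join_radius K 1 N"
  define C where "C = 1 + R * (3 + \<epsilon>\<^sub>1)"
  have E0: "0 \<le> E" "0 \<le> E'" "0 \<le> e" "0 \<le> H 0" "0 \<le> K"
    using H_nonneg K_ge_1 by (auto simp: E_def E'_def e_def)
  have R0: "0 \<le> R" unfolding R_def using E0 by (intro join_radius_nonneg) auto
  \<comment> \<open>The last entry brings the tolerance \<kappa> for \<open>z\<close> below the
    tolerance of the net.\<close>
  define r\<^sub>0 where "r\<^sub>0 = Max {r\<^sub>1, E + e, E', 2 * c / \<epsilon>, 8 * \<kappa> / \<epsilon>\<^sub>1}"
  have "\<exists>h\<in>X. dist y h \<le> C * r \<and> dist h (\<mu> y b h) \<le> \<epsilon> * r \<and>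
    (\<forall>z\<in>X. dist y z \<le> r \<longrightarrow> dist z (\<mu> y b z) \<le> \<kappa> \<longrightarrow> dist z (\<mu> y z h) \<le> \<epsilon> * r)"
    if r: "r\<^sub>0 \<le> r" and y: "y \<in> X" and b: "b \<in> X" for r y b
  proof -
    have r_ge: "r\<^sub>1 \<le> r" "E + e \<le> r" "E' \<le> r" "2 * c / \<epsilon> \<le> r" "8 * \<kappa> / \<epsilon>\<^sub>1 \<le> r"
      using r by (simp_all add: r\<^sub>0_def)
    then have r': "0 < r" "2 * c \<le> \<epsilon> * r" "\<kappa> \<le> \<epsilon>\<^sub>1 * r / 8"
      using r1 \<epsilon> \<epsilon>1 by (simp_all add: field_simps)
    have \<epsilon>r: "0 < \<epsilon> * r" using \<epsilon> r' by simp
    obtain F where F: "F \<subseteq> X" "finite F" "card F \<le> N"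
        "\<And>f. f \<in> F \<Longrightarrow> dist y f \<le> r" "\<And>f. f \<in> F \<Longrightarrow> dist f (\<mu> y b f) \<le> \<epsilon>\<^sub>1 * r / 8"
      and cover: "\<And>z. z \<in> X \<Longrightarrow> dist y z \<le> r \<Longrightarrow> dist z (\<mu> y b z) \<le> \<epsilon>\<^sub>1 * r / 8
        \<Longrightarrow> \<exists>f\<in>F. dist z f \<le> \<epsilon>\<^sub>1 * r"
      using net[rule_format, OF r_ge(1) y b] by blast
    define A where "A = {y, b} \<union> F"
    have A: "A \<subseteq> X" "finite A" "A \<noteq> {}" using y b F by (auto simp: A_def)
    have "card A \<le> card {y, b} + card F" unfolding A_def by (rule card_Un_le)
    also have "\<dots> \<le> n" using F(3) by (auto simp: n_def card_insert_if)
    finally have "card A \<le> n" .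
    then obtain P m \<pi> \<sigma> where "coarse_median_approximation X \<mu> K H d P m A E \<pi> \<sigma>"
      using approximation_exists[OF A] unfolding E_def by blast
    then interpret P: coarse_median_approximation X \<mu> K H d P m A E \<pi> \<sigma> .
    interpret L: median_interval_lattice P m "\<pi> y" "\<pi> b"
      using P.\<pi> P.finite_P by unfold_locales (auto simp: A_def)
    have yA: "y \<in> A" and bA: "b \<in> A" and FA: "\<And>f. f \<in> F \<Longrightarrow> f \<in> A" by (auto simp: A_def)
    define \<rho> where "\<rho> f = m (\<pi> y) (\<pi> b) (\<pi> f)" for f
    have near: "dist (\<sigma> (\<rho> f)) f \<le> e + \<epsilon>\<^sub>1 * r / 8" if "f \<in> F" for f
    proof -
      have "dist (\<sigma> (\<rho> f)) (\<mu> y b f) \<le> e" unfolding \<rho>_def e_def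
        using that FA yA bA P.\<pi> F(1) y b by (intro P.\<sigma>_median_near P.\<sigma>_\<pi>') auto
      then show ?thesis using dist_triangle2[of "\<sigma> (\<rho> f)" f "\<mu> y b f"] F(5)[OF that] by simp
    qed
    have far: "dist (\<sigma> (\<pi> y)) (\<sigma> (\<rho> f)) \<le> (2 + \<epsilon>\<^sub>1) * r" if "f \<in> F" for f
    proof -
      have "dist (\<sigma> (\<pi> y)) (\<sigma> (\<rho> f)) \<le> dist (\<sigma> (\<pi> y)) y + dist y f + dist (\<sigma> (\<rho> f)) f"
        using dist_triangle[of "\<sigma> (\<pi> y)" "\<sigma> (\<rho> f)" y] dist_triangle2[of y "\<sigma> (\<rho> f)" f] by simp
      also have "\<dots> \<le> E + r + (e + \<epsilon>\<^sub>1 * r / 8)"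
        using that F near yA by (intro add_mono P.\<sigma>_\<pi>') auto
      also have "\<dots> \<le> (2 + \<epsilon>\<^sub>1) * r"
      proof -
        have "0 \<le> \<epsilon>\<^sub>1 * r" using \<epsilon>1 r' by simp
        then show ?thesis using r_ge by (simp add: algebra_simps)
      qed
      finally show ?thesis .
    qed
    have "\<exists>h\<in>L.I. (\<forall>x\<in>\<rho> ` F. L.le x h) \<and>
      dist (\<sigma> (\<pi> y)) (\<sigma> h) \<le> join_radius K 1 (card (\<rho> ` F)) * ((2 + \<epsilon>\<^sub>1) * r + E')"
    proof (rule L.join_bound)
      show "\<rho> ` F \<subseteq> L.I" using L.gate_in_I P.\<pi> FA by (auto simp: \<rho>_def)
      show "dist (\<sigma> (m x y z)) (\<sigma> (m x' y' z'))
        \<le> K * (dist (\<sigma> x) (\<sigma> x') + dist (\<sigma> y) (\<sigma> y') + dist (\<sigma> z) (\<sigma> z')) + E'"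
        if "x \<in> P" "y \<in> P" "z \<in> P" "x' \<in> P" "y' \<in> P" "z' \<in> P" for x y z x' y' z'
        using P.\<sigma>_lipschitz[OF that] by (simp add: E'_def)
    qed (use E0 \<epsilon>1 r' F far in auto)
    then obtain h where h: "h \<in> L.I" "\<And>f. f \<in> F \<Longrightarrow> L.le (\<rho> f) h"
      "dist (\<sigma> (\<pi> y)) (\<sigma> h) \<le> join_radius K 1 (card (\<rho> ` F)) * ((2 + \<epsilon>\<^sub>1) * r + E')" by blast
    have hP: "h \<in> P" "\<sigma> h \<in> X" "\<pi> y \<in> P" "\<pi> b \<in> P" using h L.I_carrier P.\<sigma> L.p L.q by auto
    have "dist y (\<sigma> h) \<le> C * r"
    proof -
      have "card (\<rho> ` F) \<le> N" using F card_image_le le_trans by blast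
      then have "join_radius K 1 (card (\<rho> ` F)) \<le> R"
        unfolding R_def using K_ge_1 by (intro join_radius_mono) auto
      moreover have "0 \<le> (2 + \<epsilon>\<^sub>1) * r + E'" using E0 \<epsilon>1 r' by simp
      ultimately have "dist (\<sigma> (\<pi> y)) (\<sigma> h) \<le> R * ((2 + \<epsilon>\<^sub>1) * r + E')"
        using h(3) by (meson mult_right_mono order_trans)
      also have "\<dots> \<le> R * ((2 + \<epsilon>\<^sub>1) * r + r)" using R0 r_ge by (intro mult_left_mono) auto
      finally have "dist (\<sigma> (\<pi> y)) (\<sigma> h) \<le> R * (3 + \<epsilon>\<^sub>1) * r" by (simp add: algebra_simps)
      then show ?thesis
        using dist_triangle[of y "\<sigma> h" "\<sigma> (\<pi> y)"] P.\<sigma>_\<pi>[OF yA] r_ge E0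
        by (simp add: C_def distrib_right)
    qed
    moreover have "dist (\<sigma> h) (\<mu> y b (\<sigma> h)) \<le> \<epsilon> * r"
    proof -
      have "dist (\<sigma> (m (\<pi> y) (\<pi> b) h)) (\<mu> y b (\<sigma> h)) \<le> E + K * (E + E + 0) + H 0"
        using hP yA bA y b by (intro P.\<sigma>_median_near P.\<sigma>_\<pi>') auto
      moreover have "m (\<pi> y) (\<pi> b) h = h" using h(1) by (simp add: L.in_I_iff)
      moreover have "E + K * (E + E + 0) + H 0 \<le> c"
      proof -
        have "E + K * (E + E + 0) + H 0 \<le> e" using E0 by (simp add: e_def distrib_left)
        also have "e \<le> c" using E0 by (simp add: c_def distrib_right)
        finally show ?thesis .
      qed
      moreover have "c \<le> \<epsilon> * r" using r'(2) \<epsilon>r by linarith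
      ultimately show ?thesis by simp
    qed
    moreover have "dist z (\<mu> y z (\<sigma> h)) \<le> \<epsilon> * r"
      if z: "z \<in> X" "dist y z \<le> r" "dist z (\<mu> y b z) \<le> \<kappa>" for z
    proof -
      obtain f where f: "f \<in> F" "dist z f \<le> \<epsilon>\<^sub>1 * r" using cover[of z] z r'(3) by fastforce
      define \<alpha> where "\<alpha> = e + \<epsilon>\<^sub>1 * r / 8 + \<epsilon>\<^sub>1 * r"
      have \<alpha>: "dist (\<sigma> (\<rho> f)) z \<le> \<alpha>"
        using near[OF f(1)] f(2) dist_triangle2[of "\<sigma> (\<rho> f)" z f] by (simp add: \<alpha>_def)
      have fP: "\<rho> f \<in> P" using f FA P.\<pi> hP P.closed by (simp add: \<rho>_def)
      have "m (\<pi> y) (\<rho> f) h = \<rho> f" using h(2)[OF f(1)] by (simp add: L.le_def L.meet_def)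
      moreover have "dist (\<sigma> (m (\<pi> y) (\<rho> f) h)) (\<mu> y z (\<sigma> h)) \<le> E + K * (E + \<alpha> + 0) + H 0"
        using hP fP \<alpha> yA y z by (intro P.\<sigma>_median_near P.\<sigma>_\<pi>') auto
      ultimately have "dist z (\<mu> y z (\<sigma> h)) \<le> \<alpha> + (E + K * (E + \<alpha> + 0) + H 0)"
        using dist_triangle3[of z "\<mu> y z (\<sigma> h)" "\<sigma> (\<rho> f)"] \<alpha> by simp
      also have "\<dots> = c + (9 / 8) * ((1 + K) * \<epsilon>\<^sub>1) * r" by (simp add: \<alpha>_def c_def algebra_simps)
      also have "\<dots> = c + (9 / 32) * (\<epsilon> * r)" by (simp add: \<epsilon>1)
      also have "\<dots> \<le> \<epsilon> * r" using r'(2) \<epsilon>r by linarith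
      finally show ?thesis .
    qed
    ultimately show ?thesis using hP by blast
  qed
  moreover have "0 \<le> C" using R0 \<epsilon>1 by (simp add: C_def)
  ultimately show ?thesis by blast
qed

text \<open>\<open>h y\<close> is a deep point of \<open>[y, b]\<close> at scale
  \<open>3 * K * l\<close>. For \<open>y\<close> within \<open>2 * l\<close> of \<open>x\<close> the
  median of \<open>x\<close>, \<open>y\<close>, \<open>b\<close> is close enough to \<open>y\<close>
  to lie below \<open>h y\<close>, so \<open>interval_transfer\<close> puts \<open>h y\<close>
  coarsely into \<open>[x, b]\<close>. There \<open>N\<close> balls of radius
  \<open>\<theta> * l\<close> suffice, and the growth bound counts their points.\<close>

lemma subexponential_fibres:
  assumes c: "1 \<le> c" and c': "1 \<le> c'"
    and growth: "\<And>x R. x \<in> X \<Longrightarrow> 0 \<le> R \<Longrightarrow> finite (X \<inter> cball x R) \<and> real (card (X \<inter> cball x R)) \<le> c' * c powr R"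
    and \<alpha>: "0 < \<alpha>"
  shows "\<exists>l\<ge>l\<^sub>0. \<exists>h B. h ` X \<subseteq> X \<and> (\<forall>y\<in>X. dist y (h y) \<le> B) \<and> (\<forall>x\<in>X. finite (h ` (X \<inter> cball x (2 * l))) \<and>
    real (card (h ` (X \<inter> cball x (2 * l)))) \<le> exp (\<alpha> * l))"
proof (cases "X = {}")
  case False
  then obtain b where b: "b \<in> X" by blast
  obtain \<kappa> where \<kappa>: "0 \<le> \<kappa>" and \<kappa>_I: "\<And>x y. x \<in> X \<Longrightarrow> y \<in> X \<Longrightarrow>
      dist (\<mu> x y b) (\<mu> y b (\<mu> x y b)) \<le> \<kappa> \<and> dist y (\<mu> x y b) \<le> K * dist x y + \<kappa>"
    using median_in_interval b by blast
  obtain a k where a: "0 < a" and transfer: "\<And>x y h \<eta>. x \<in> X \<Longrightarrow> y \<in> X \<Longrightarrow> h \<in> X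
      \<Longrightarrow> dist h (\<mu> y b h) \<le> \<eta> \<Longrightarrow> dist (\<mu> x y b) (\<mu> y (\<mu> x y b) h) \<le> \<eta> \<Longrightarrow> dist h (\<mu> x b h) \<le> a * \<eta> + k"
    using interval_transfer b by blast
  \<comment> \<open>This gives \<open>c powr (\<theta> * l) \<le> exp (\<alpha> * l / 2)\<close>;
    the summand 1 keeps the denominator positive when \<open>c = 1\<close>.\<close>
  define \<theta> where "\<theta> = \<alpha> / (2 * (ln c + 1))"
  have lnc: "0 \<le> ln c" using c by simp
  have \<theta>: "0 < \<theta>" "\<theta> * ln c \<le> \<alpha> / 2"
    using \<alpha> lnc by (auto simp: \<theta>_def field_simps)
  \<comment> \<open>After the transfer the error is \<open>\<theta> * l / 16 + k\<close>, which for
    large \<open>l\<close> meets the tolerance \<open>\<theta> * l / 8\<close> of the net.\<close>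
  define \<eta> where "\<eta> = \<theta> / (48 * K * a)"
  have \<eta>: "0 < \<eta>" using \<theta> a K_ge_1 by (simp add: \<eta>_def)
  obtain C\<^sub>1 r\<^sub>1 where C1: "0 \<le> C\<^sub>1" and deep: "\<And>r y. r\<^sub>1 \<le> r \<Longrightarrow> y \<in> X \<Longrightarrow> \<exists>h\<in>X. dist y h \<le> C\<^sub>1 * r \<and>
      dist h (\<mu> y b h) \<le> \<eta> * r \<and>
      (\<forall>z\<in>X. dist y z \<le> r \<longrightarrow> dist z (\<mu> y b z) \<le> \<kappa> \<longrightarrow> dist z (\<mu> y z h) \<le> \<eta> * r)"
    using deep_point[OF \<eta> \<kappa>] b by blast
  \<comment> \<open>Distance from \<open>x\<close> to \<open>h y\<close> in units of
    \<open>l\<close>: 2 from \<open>x\<close> to \<open>y\<close>, and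
    \<open>3 * K * C\<^sub>1\<close> from \<open>y\<close> to \<open>h y\<close>.\<close>
  define C where "C = 2 + 3 * K * C\<^sub>1"
  have C: "0 < C" using C1 K_ge_1 by (simp add: C_def add_pos_nonneg)
  have \<theta>C: "0 < \<theta> / C" using \<theta> C by simp
  obtain N r\<^sub>2 where "0 < r\<^sub>2" and N: "\<forall>r\<ge>r\<^sub>2. \<forall>y\<in>X. \<forall>b\<in>X.
    \<exists>F\<subseteq>{f \<in> X. dist y f \<le> r \<and> dist f (\<mu> y b f) \<le> \<theta> / C * r / 8}. finite F \<and> card F \<le> N \<and>
      (\<forall>f\<in>X. dist y f \<le> r \<longrightarrow> dist f (\<mu> y b f) \<le> \<theta> / C * r / 8 \<longrightarrow> (\<exists>z\<in>F. dist f z \<le> \<theta> / C * r))"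
    using interval_net[OF \<theta>C] by blast
  note net = N[rule_format, OF _ _ b]
  \<comment> \<open>The last entry absorbs \<open>N * c'\<close> into
    \<open>exp (\<alpha> * l / 2)\<close>, which is possible because \<open>N\<close> is fixed
    before \<open>l\<close>.\<close>
  define l where "l = Max {1, l\<^sub>0, \<kappa>, 16 * k / \<theta>, r\<^sub>1 / (3 * K), r\<^sub>2 / C, 2 * ln (N * c' + 1) / \<alpha>}"
  have l_ge: "1 \<le> l" "l\<^sub>0 \<le> l" "\<kappa> \<le> l" "16 * k / \<theta> \<le> l" "r\<^sub>1 / (3 * K) \<le> l" "r\<^sub>2 / C \<le> l"
      "2 * ln (N * c' + 1) / \<alpha> \<le> l"
    unfolding l_def by (rule Max_ge, simp, simp)+
  then have l: "0 < l" "16 * k \<le> \<theta> * l" "r\<^sub>1 \<le> 3 * K * l" "r\<^sub>2 \<le> C * l" "ln (N * c' + 1) \<le> \<alpha> * l / 2"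
    using \<theta> C \<alpha> K_ge_1 by (simp_all add: field_simps)
  obtain h where h: "\<And>y. y \<in> X \<Longrightarrow> h y \<in> X \<and> dist y (h y) \<le> C\<^sub>1 * (3 * K * l) \<and>
      dist (h y) (\<mu> y b (h y)) \<le> \<eta> * (3 * K * l) \<and>
      (\<forall>z\<in>X. dist y z \<le> 3 * K * l \<longrightarrow> dist z (\<mu> y b z) \<le> \<kappa> \<longrightarrow> dist z (\<mu> y z (h y)) \<le> \<eta> * (3 * K * l))"
    using deep[OF l(3)] by metis
  have "finite (h ` (X \<inter> cball x (2 * l))) \<and> real (card (h ` (X \<inter> cball x (2 * l)))) \<le> exp (\<alpha> * l)"
    if x: "x \<in> X" for x
  proof -
    obtain F where F: "F \<subseteq> X" "finite F" "card F \<le> N" and cover: "\<And>f. f \<in> X \<Longrightarrow> dist x f \<le> C * l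
        \<Longrightarrow> dist f (\<mu> x b f) \<le> \<theta> / C * (C * l) / 8 \<Longrightarrow> \<exists>z\<in>F. dist f z \<le> \<theta> / C * (C * l)"
      using net[OF l(4) x] by blast
    have sub: "h ` (X \<inter> cball x (2 * l)) \<subseteq> (\<Union>z\<in>F. X \<inter> cball z (\<theta> * l))"
    proof
      fix w assume "w \<in> h ` (X \<inter> cball x (2 * l))"
      then obtain y where y: "y \<in> X" "dist x y \<le> 2 * l" "w = h y" by auto
      let ?m = "\<mu> x y b"
      have m: "?m \<in> X" using x y b closed by simp
      have "K * dist x y \<le> K * (2 * l)" using y K_ge_1 by (intro mult_left_mono) auto
      moreover have "1 * l \<le> K * l" using K_ge_1 l by (intro mult_right_mono) auto
      moreover have "dist y ?m \<le> K * dist x y + \<kappa>" using \<kappa>_I[OF x y(1)] by blast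
      moreover have "3 * K * l = K * (2 * l) + K * l" by simp
      ultimately have "dist y ?m \<le> 3 * K * l" using l_ge(3) by linarith
      then have "dist ?m (\<mu> y ?m (h y)) \<le> \<eta> * (3 * K * l)"
        using h[OF y(1)] m \<kappa>_I[OF x y(1)] by blast
      then have "dist w (\<mu> x b w) \<le> a * (\<eta> * (3 * K * l)) + k"
        using h[OF y(1)] x y by (intro transfer[of x y]) auto
      also have "a * (\<eta> * (3 * K * l)) = \<theta> * l / 16"
        using a K_ge_1 by (simp add: \<eta>_def)
      finally have "dist w (\<mu> x b w) \<le> \<theta> * l / 8" using l by simp
      moreover have "dist x w \<le> C * l"
        using dist_triangle[of x w y] h[OF y(1)] y by (simp add: C_def algebra_simps)
      ultimately obtain z where "z \<in> F" "dist w z \<le> \<theta> * l"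
        using cover[of w] h[OF y(1)] y C by auto
      then show "w \<in> (\<Union>z\<in>F. X \<inter> cball z (\<theta> * l))"
        using h[OF y(1)] y by (auto simp: dist_commute)
    qed
    have fin: "finite (\<Union>z\<in>F. X \<inter> cball z (\<theta> * l))"
      using F growth \<theta> l by (intro finite_UN_I) auto
    have "real (card (h ` (X \<inter> cball x (2 * l)))) \<le> real (card (\<Union>z\<in>F. X \<inter> cball z (\<theta> * l)))"
      using card_mono[OF fin sub] by simp
    also have "\<dots> \<le> (\<Sum>z\<in>F. real (card (X \<inter> cball z (\<theta> * l))))"
      using card_UN_le[OF F(2), of "\<lambda>z. X \<inter> cball z (\<theta> * l)"] by (simp flip: of_nat_sum)
    also have "\<dots> \<le> (\<Sum>z\<in>F. c' * c powr (\<theta> * l))"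
      using F growth \<theta> l by (intro sum_mono) auto
    also have "\<dots> = real (card F) * c' * c powr (\<theta> * l)" by simp
    also have "\<dots> \<le> exp (\<alpha> * l / 2) * exp (\<alpha> * l / 2)"
    proof (rule mult_mono)
      have "real (card F) * c' \<le> N * c' + 1" using F(3) c' by (simp add: mult_right_mono add_increasing2)
      also have "\<dots> = exp (ln (N * c' + 1))" using c' by (simp add: add_nonneg_pos)
      also have "\<dots> \<le> exp (\<alpha> * l / 2)" using l by simp
      finally show "real (card F) * c' \<le> exp (\<alpha> * l / 2)" .
      have "\<theta> * ln c * l \<le> \<alpha> / 2 * l" using \<theta> l by (intro mult_right_mono) auto
      then show "c powr (\<theta> * l) \<le> exp (\<alpha> * l / 2)" using c by (simp add: powr_def algebra_simps)
    qed auto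
    also have "\<dots> = exp (\<alpha> * l)" by (simp flip: exp_add)
    finally show ?thesis using fin sub finite_subset by blast
  qed
  moreover have "h ` X \<subseteq> X" "\<forall>y\<in>X. dist y (h y) \<le> C\<^sub>1 * (3 * K * l)" using h by auto
  ultimately show ?thesis using l_ge(2) by blast
qed auto

end

section \<open>Property A\<close>

lemma ell1_finite_support:
  assumes "finite T" "T \<subseteq> X" "\<And>z. z \<in> X - T \<Longrightarrow> f z = (0::real)"
  shows "f \<in> ell1 X" and "ell1_norm X f = (\<Sum>z\<in>T. \<bar>f z\<bar>)"
proof -
  have "(\<lambda>z. \<bar>f z\<bar>) summable_on X \<longleftrightarrow> (\<lambda>z. \<bar>f z\<bar>) summable_on T"
    using assms by (intro summable_on_cong_neutral) auto
  then show "f \<in> ell1 X" using assms(1) by (simp add: ell1_def)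
  have "ell1_norm X f = (\<Sum>\<^sub>\<infinity>z\<in>T. \<bar>f z\<bar>)"
    unfolding ell1_norm_def using assms by (intro infsum_cong_neutral) auto
  then show "ell1_norm X f = (\<Sum>z\<in>T. \<bar>f z\<bar>)" using assms(1) by simp
qed

text \<open>With norms \<open>A\<close> and \<open>B\<close>, split \<open>f / A - g / B\<close>
  into \<open>(f - g) / A\<close> and \<open>g * (1 / A - 1 / B)\<close>. The norms differ by at
  most the distance of \<open>f\<close> and \<open>g\<close>, so each part contributes at most this
  distance over \<open>A\<close>.\<close>

lemma normalised_difference:
  fixes f g :: "'a \<Rightarrow> real"
  assumes T: "finite T" and a: "0 < (\<Sum>z\<in>T. \<bar>f z\<bar>)" and b: "0 < (\<Sum>z\<in>T. \<bar>g z\<bar>)"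
  shows "(\<Sum>z\<in>T. \<bar>f z / (\<Sum>z\<in>T. \<bar>f z\<bar>) - g z / (\<Sum>z\<in>T. \<bar>g z\<bar>)\<bar>)
    \<le> 2 * (\<Sum>z\<in>T. \<bar>f z - g z\<bar>) / (\<Sum>z\<in>T. \<bar>f z\<bar>)"
proof -
  define A where "A = (\<Sum>z\<in>T. \<bar>f z\<bar>)"
  define B where "B = (\<Sum>z\<in>T. \<bar>g z\<bar>)"
  define \<Delta> where "\<Delta> = (\<Sum>z\<in>T. \<bar>f z - g z\<bar>)"
  have pos: "0 < A" "0 < B" using a b by (auto simp: A_def B_def)
  have "A - B = (\<Sum>z\<in>T. \<bar>f z\<bar> - \<bar>g z\<bar>)" by (simp add: A_def B_def sum_subtractf)
  then have "\<bar>A - B\<bar> \<le> (\<Sum>z\<in>T. \<bar>\<bar>f z\<bar> - \<bar>g z\<bar>\<bar>)" by simp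
  also have "\<dots> \<le> \<Delta>" unfolding \<Delta>_def by (intro sum_mono) auto
  finally have AB: "\<bar>A - B\<bar> \<le> \<Delta>" .
  have "\<bar>f z / A - g z / B\<bar> \<le> \<bar>f z - g z\<bar> / A + \<bar>g z\<bar> * (\<Delta> / (A * B))" for z
  proof -
    have "f z / A - g z / B = (f z - g z) / A + g z * ((B - A) / (A * B))"
      using pos by (simp add: field_simps)
    also have "\<bar>\<dots>\<bar> \<le> \<bar>f z - g z\<bar> / A + \<bar>g z\<bar> * (\<bar>A - B\<bar> / (A * B))"
      using pos by (intro order_trans[OF abs_triangle_ineq]) (simp add: abs_mult abs_minus_commute)
    also have "\<bar>g z\<bar> * (\<bar>A - B\<bar> / (A * B)) \<le> \<bar>g z\<bar> * (\<Delta> / (A * B))"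
      using AB pos by (intro mult_left_mono divide_right_mono) auto
    finally show ?thesis by simp
  qed
  then have "(\<Sum>z\<in>T. \<bar>f z / A - g z / B\<bar>) \<le> (\<Sum>z\<in>T. \<bar>f z - g z\<bar> / A + \<bar>g z\<bar> * (\<Delta> / (A * B)))"
    by (rule sum_mono)
  also have "\<dots> = \<Delta> / A + B * (\<Delta> / (A * B))"
    by (simp add: sum.distrib \<Delta>_def B_def sum_divide_distrib sum_distrib_right)
  also have "\<dots> = 2 * \<Delta> / A" using pos by (simp add: field_simps)
  finally show ?thesis by (simp add: A_def B_def \<Delta>_def)
qed

text \<open>The weight of \<open>z\<close> at \<open>x\<close> decays exponentially, at the slow rate \<open>\<alpha>\<close>, with the distance from \<open>x\<close>
  to the fibre of \<open>h\<close> over \<open>z\<close>. The cut-off at distance \<open>l\<close> contributes at most \<open>exp (- \<alpha> l)\<close> for each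
  point of \<open>h (B(x, 2 l))\<close>, which the bound on the number of these points makes harmless.\<close>

lemma property_A_if_subexponential_fibres:
  fixes X :: "'a::metric_space set"
  assumes fibres: "\<And>\<alpha> l\<^sub>0. 0 < \<alpha> \<Longrightarrow> \<exists>l\<ge>l\<^sub>0. \<exists>h B. h ` X \<subseteq> X \<and> (\<forall>y\<in>X. dist y (h y) \<le> B) \<and>
    (\<forall>x\<in>X. finite (h ` (X \<inter> cball x (2 * l))) \<and>
      real (card (h ` (X \<inter> cball x (2 * l)))) \<le> exp (\<alpha> * l))"
  shows "property_A X"
  unfolding property_A_def
proof (intro allI impI)
  fix R \<epsilon> :: real assume R: "0 < R" and \<epsilon>: "0 < \<epsilon>"
  \<comment> \<open>A move of length at most \<open>R\<close> changes the exponential weights by a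
    factor of at most \<open>1 + \<epsilon> / 6\<close>.\<close>
  define \<alpha> where "\<alpha> = ln (1 + \<epsilon> / 6) / R"
  have \<alpha>: "0 < \<alpha>" "exp (\<alpha> * R) = 1 + \<epsilon> / 6" using R \<epsilon> by (auto simp: \<alpha>_def)
  \<comment> \<open>The bound \<open>ln 2 / \<alpha>\<close> makes the cut-off level at most
    \<open>1 / 2\<close>, so that the total weight is at least \<open>1 / 2\<close>.\<close>
  obtain l h B where l: "max (max 1 R) (ln 2 / \<alpha>) \<le> l" and hX: "h ` X \<subseteq> X"
      and B: "\<And>y. y \<in> X \<Longrightarrow> dist y (h y) \<le> B"
      and fin: "\<And>x. x \<in> X \<Longrightarrow> finite (h ` (X \<inter> cball x (2 * l)))"
      and card: "\<And>x. x \<in> X \<Longrightarrow> real (card (h ` (X \<inter> cball x (2 * l)))) \<le> exp (\<alpha> * l)"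
    using fibres[OF \<alpha>(1)] by metis
  have l': "1 \<le> l" "R \<le> l" "exp (- \<alpha> * l) \<le> 1 / 2"
  proof -
    have "ln 2 \<le> \<alpha> * l" using l \<alpha>(1) by (simp add: field_simps)
    then have "exp (- \<alpha> * l) \<le> exp (- ln 2)" by simp
    then show "exp (- \<alpha> * l) \<le> 1 / 2" by (simp add: exp_minus)
  qed (use l in auto)
  define fib where "fib z = {y \<in> X. h y = z}" for z
  \<comment> \<open>\<open>infdist\<close> to the empty set is 0, so points outside the range of
    \<open>h\<close> must be given weight 0 explicitly.\<close>
  define \<psi> where "\<psi> x z = (if z \<in> h ` X then max 0 (exp (- \<alpha> * infdist x (fib z)) - exp (- \<alpha> * l)) else 0)"
    for x z
  define S where "S x = h ` (X \<inter> cball x (2 * l))" for x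
  have S: "finite (S x)" "S x \<subseteq> X" if "x \<in> X" for x using fin that hX by (auto simp: S_def)
  have nonneg: "0 \<le> \<psi> x z" for x z by (simp add: \<psi>_def)
  have supp: "\<exists>y\<in>X. z = h y \<and> dist x y < l" if nz: "\<psi> x z \<noteq> 0" for x z
  proof -
    have z: "z \<in> h ` X" and "0 < exp (- \<alpha> * infdist x (fib z)) - exp (- \<alpha> * l)"
      using nz by (auto simp: \<psi>_def max_def less_le split: if_splits)
    then have lt: "infdist x (fib z) < l" using \<alpha>(1) by simp
    have "fib z \<noteq> {}" using z by (auto simp: fib_def)
    then have "\<exists>y\<in>fib z. dist x y < l"
      using lt by (simp add: infdist_notempty cINF_less_iff)
    then show ?thesis by (auto simp: fib_def)
  qed
  \<comment> \<open>A nonzero weight comes from some \<open>y\<close> within \<open>l\<close> of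
    \<open>x\<close>, hence within \<open>l + R \<le> 2 * l\<close> of \<open>x'\<close>. So
    \<open>S x'\<close> supports the weights of all points near \<open>x'\<close>.\<close>
  have supp0: "\<psi> x z = 0" if "z \<notin> S x'" "dist x x' \<le> R" for x x' z
  proof (rule ccontr)
    assume "\<psi> x z \<noteq> 0"
    then obtain y where y: "y \<in> X" "z = h y" "dist x y < l" using supp by blast
    then have "dist x' y \<le> 2 * l" using dist_triangle3[of x' y x] that(2) l' by (simp add: dist_commute)
    then show False using that(1) y by (auto simp: S_def)
  qed
  \<comment> \<open>Before the cut-off the weight changes by a factor between \<open>1 / q\<close>
    and \<open>q\<close>; it exceeds the truncated weight by at most \<open>v\<close> where that is
    positive, and is at most \<open>v\<close> elsewhere.\<close>
  have lip: "\<bar>\<psi> x z - \<psi> x' z\<bar> \<le> (exp (\<alpha> * R) - 1) * (\<psi> x z + exp (- \<alpha> * l))"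
    if xx': "dist x x' \<le> R" for x x' z
  proof (cases "z \<in> h ` X")
    case True
    define t where "t = infdist x (fib z)"
    define t' where "t' = infdist x' (fib z)"
    have tt': "\<bar>t - t'\<bar> \<le> R" using infdist_triangle_abs xx' order_trans unfolding t_def t'_def by blast
    have e1: "1 \<le> exp (\<alpha> * R)" using \<alpha> \<epsilon> by simp
    have A: "exp (- \<alpha> * t') \<le> exp (\<alpha> * R) * exp (- \<alpha> * t)"
    proof -
      have "- \<alpha> * t' \<le> \<alpha> * R + - \<alpha> * t"
        using tt' \<alpha>(1) mult_left_mono[of "t - t'" R \<alpha>] by (simp add: algebra_simps)
      then show ?thesis by (simp flip: exp_add)
    qed
    have A': "exp (- \<alpha> * t) \<le> exp (\<alpha> * R) * exp (- \<alpha> * t')"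
    proof -
      have "- \<alpha> * t \<le> \<alpha> * R + - \<alpha> * t'"
        using tt' \<alpha>(1) mult_left_mono[of "t' - t" R \<alpha>] by (simp add: algebra_simps)
      then show ?thesis by (simp flip: exp_add)
    qed
    define u where "u = exp (- \<alpha> * t)"
    define u' where "u' = exp (- \<alpha> * t')"
    define v where "v = exp (- \<alpha> * l)"
    define q where "q = exp (\<alpha> * R)"
    have q: "1 \<le> q" "u' \<le> q * u" "u \<le> q * u'" "0 < v" "0 < u" "0 < u'"
      using A A' e1 by (auto simp: u_def u'_def v_def q_def)
    have m: "u \<le> max 0 (u - v) + v" by simp
    have up: "max 0 (u' - v) - max 0 (u - v) \<le> (q - 1) * (max 0 (u - v) + v)"
    proof -
      have "(q - 1) * u \<le> (q - 1) * (max 0 (u - v) + v)" using q m by (intro mult_left_mono) auto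
      moreover have "u' - u \<le> (q - 1) * u" using q(2) by (simp add: algebra_simps)
      moreover have "v < u \<Longrightarrow> max 0 (u' - v) - max 0 (u - v) \<le> max 0 (u' - u)" using q by auto
      moreover have "0 \<le> (q - 1) * (max 0 (u - v) + v)" using q by (intro mult_nonneg_nonneg) auto
      moreover have "u' - v \<le> (q - 1) * v" if "u \<le> v"
      proof -
        have "u' \<le> q * v" using q(1,2) that by (smt (verit) mult_left_mono)
        then show ?thesis by (simp add: algebra_simps)
      qed
      ultimately show ?thesis by (cases "u \<le> v") auto
    qed
    have down: "max 0 (u - v) - max 0 (u' - v) \<le> (q - 1) * (max 0 (u - v) + v)"
    proof -
      have "max 0 (u - v) - max 0 (u' - v) \<le> max 0 (u - u')" by auto
      moreover have "u - u' \<le> (q - 1) * u"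
      proof -
        \<comment> \<open>\<open>u'\<close> is at least \<open>u / q\<close>, and
          \<open>(2 - q) * q \<le> 1\<close> because \<open>(q - 1)\<^sup>2\<close> is
          nonnegative.\<close>
        have "u * (2 - q) \<le> u'"
        proof -
          have "u * (2 - q) * q \<le> u * 1"
            unfolding mult.assoc using q(5) sum_power2_ge_zero[of "q - 1" 0]
            by (intro mult_left_mono) (auto simp: algebra_simps power2_eq_square)
          also have "\<dots> \<le> u' * q" using q(3) by (simp add: mult.commute)
          finally show ?thesis using q(1) by (simp add: mult_right_le_imp_le)
        qed
        then show ?thesis by (simp add: algebra_simps)
      qed
      moreover have "0 \<le> (q - 1) * u" using q by simp
      moreover have "(q - 1) * u \<le> (q - 1) * (max 0 (u - v) + v)" using q m by (intro mult_left_mono) auto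
      ultimately show ?thesis by linarith
    qed
    have "\<psi> x z = max 0 (u - v)" "\<psi> x' z = max 0 (u' - v)"
      using True by (simp_all add: \<psi>_def u_def u'_def v_def t_def t'_def)
    then have "\<bar>\<psi> x z - \<psi> x' z\<bar> \<le> (q - 1) * (\<psi> x z + v)" using up down by (simp add: abs_le_iff)
    then show ?thesis by (simp only: v_def q_def)
  next
    case False
    then show ?thesis using \<alpha> \<epsilon> by (simp add: \<psi>_def)
  qed
  define w where "w x = (\<Sum>z\<in>S x. \<bar>\<psi> x z\<bar>)" for x
  have w_eq: "(\<Sum>z\<in>T. \<bar>\<psi> x z\<bar>) = w x" if "finite T" "S x \<subseteq> T" for x T
    unfolding w_def using that supp0[of _ x x] R by (intro sum.mono_neutral_right) auto
  have w: "1 / 2 \<le> w x" if x: "x \<in> X" for x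
  proof -
    have "infdist x (fib (h x)) = 0" using x by (auto simp: fib_def)
    then have "1 / 2 \<le> \<bar>\<psi> x (h x)\<bar>" using l' \<alpha>(1) x by (simp add: \<psi>_def max_def)
    also have "\<dots> \<le> w x" unfolding w_def using x l' S by (intro member_le_sum) (auto simp: S_def)
    finally show ?thesis .
  qed
  define \<xi> where "\<xi> x z = \<psi> x z / w x" for x z
  have \<xi>0: "\<xi> x z = 0" if "z \<notin> S x'" "dist x x' \<le> R" for x x' z
    using supp0[OF that] by (simp add: \<xi>_def)
  show "\<exists>\<xi>\<in>X \<rightarrow> ell1 X. (\<forall>x\<in>X. ell1_norm X (\<xi> x) = 1) \<and>
    (\<forall>x\<in>X. \<forall>y\<in>X. dist x y \<le> R \<longrightarrow> ell1_norm X (\<lambda>z. \<xi> x z - \<xi> y z) \<le> \<epsilon>) \<and>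
    (\<exists>S>0. \<forall>x\<in>X. {z \<in> X. \<xi> x z \<noteq> 0} \<subseteq> cball x S)"
  proof (intro bexI[of _ \<xi>] conjI ballI impI)
    show "\<xi> \<in> X \<rightarrow> ell1 X"
    proof
      fix x assume "x \<in> X"
      then show "\<xi> x \<in> ell1 X" using S \<xi>0[of _ x x] R by (intro ell1_finite_support[of "S x"]) auto
    qed
    fix x assume x: "x \<in> X"
    have "ell1_norm X (\<xi> x) = (\<Sum>z\<in>S x. \<bar>\<xi> x z\<bar>)"
      using S[OF x] \<xi>0[of _ x x] R by (intro ell1_finite_support) auto
    also have "\<dots> = (\<Sum>z\<in>S x. \<bar>\<psi> x z\<bar> / w x)" using w[OF x] by (simp add: \<xi>_def)
    also have "\<dots> = w x / w x" unfolding w_def by (rule sum_divide_distrib[symmetric])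
    finally show "ell1_norm X (\<xi> x) = 1" using w[OF x] by simp
  next
    fix x y assume x: "x \<in> X" and y: "y \<in> X" and xy: "dist x y \<le> R"
    let ?T = "S x \<union> S y"
    have T: "finite ?T" "?T \<subseteq> X" using S x y by auto
    \<comment> \<open>The cut-off error \<open>exp (- \<alpha> * l)\<close>, summed over the at most
      \<open>exp (\<alpha> * l)\<close> points of \<open>S x\<close>, is at most 1, and
      \<open>1 \<le> 2 * w x\<close>.\<close>
    have \<Delta>: "(\<Sum>z\<in>?T. \<bar>\<psi> x z - \<psi> y z\<bar>) \<le> (\<epsilon> / 2) * w x"
    proof -
      have "(\<Sum>z\<in>?T. \<bar>\<psi> x z - \<psi> y z\<bar>) = (\<Sum>z\<in>S x. \<bar>\<psi> x z - \<psi> y z\<bar>)"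
      proof (rule sum.mono_neutral_right)
        show "\<forall>z\<in>?T - S x. \<bar>\<psi> x z - \<psi> y z\<bar> = 0"
          using supp0[of _ x x] supp0[of _ x y] xy R by (auto simp: dist_commute)
      qed (use T in auto)
      also have "\<dots> \<le> (\<Sum>z\<in>S x. (exp (\<alpha> * R) - 1) * (\<psi> x z + exp (- \<alpha> * l)))"
        using lip[OF xy] by (intro sum_mono)
      also have "\<dots> = (exp (\<alpha> * R) - 1) * (\<Sum>z\<in>S x. \<psi> x z + exp (- \<alpha> * l))"
        by (rule sum_distrib_left[symmetric])
      also have "\<dots> = (\<epsilon> / 6) * (w x + real (card (S x)) * exp (- \<alpha> * l))"
        using nonneg by (simp add: \<alpha>(2) w_def sum.distrib)
      also have "real (card (S x)) * exp (- \<alpha> * l) \<le> exp (\<alpha> * l) * exp (- \<alpha> * l)"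
        using card[OF x] unfolding S_def by (intro mult_right_mono) auto
      also have "\<dots> = 1" by (simp flip: exp_add)
      also have "(\<epsilon> / 6) * (w x + 1) \<le> (\<epsilon> / 6) * (3 * w x)"
        using w[OF x] \<epsilon> by (intro mult_left_mono) auto
      finally show ?thesis using \<epsilon> by simp
    qed
    have wx: "(\<Sum>z\<in>?T. \<bar>\<psi> x z\<bar>) = w x" "(\<Sum>z\<in>?T. \<bar>\<psi> y z\<bar>) = w y" using T by (auto intro: w_eq)
    have "ell1_norm X (\<lambda>z. \<xi> x z - \<xi> y z) = (\<Sum>z\<in>?T. \<bar>\<xi> x z - \<xi> y z\<bar>)"
      using T \<xi>0[of _ x x] \<xi>0[of _ y y] R by (intro ell1_finite_support) auto
    also have "\<dots> \<le> 2 * (\<Sum>z\<in>?T. \<bar>\<psi> x z - \<psi> y z\<bar>) / w x"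
      using normalised_difference[OF T(1), of "\<psi> x" "\<psi> y"] w[OF x] w[OF y] unfolding wx \<xi>_def by simp
    also have "\<dots> \<le> 2 * ((\<epsilon> / 2) * w x) / w x"
      using \<Delta> w[OF x] by (intro divide_right_mono mult_left_mono) auto
    also have "\<dots> = \<epsilon>" using w[OF x] by simp
    finally show "ell1_norm X (\<lambda>z. \<xi> x z - \<xi> y z) \<le> \<epsilon>" .
  next
    show "\<exists>S>0. \<forall>x\<in>X. {z \<in> X. \<xi> x z \<noteq> 0} \<subseteq> cball x S"
    \<comment> \<open>\<open>l\<close> bounds the distance from \<open>x\<close> to some
      \<open>y\<close> in the fibre, \<open>B\<close> that from \<open>y\<close> to
      \<open>h y\<close>; the absolute value keeps the radius positive if \<open>X\<close> is
      empty.\<close>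
    proof (intro exI[of _ "l + \<bar>B\<bar>"] conjI ballI subsetI)
      fix x z assume "x \<in> X" "z \<in> {z \<in> X. \<xi> x z \<noteq> 0}"
      then obtain y where y: "y \<in> X" "z = h y" "dist x y < l" using supp[of x z] by (auto simp: \<xi>_def)
      then show "z \<in> cball x (l + \<bar>B\<bar>)"
        using dist_triangle[of x z y] B[of y] by auto
    qed (use l' in auto)
  qed
qed

theorem theorem6p5:
  fixes X :: "'a::metric_space set" and \<mu> :: "'a \<Rightarrow> 'a \<Rightarrow> 'a \<Rightarrow> 'a"
  assumes "coarse_median_space X \<mu>"
    and "coarse_median_finite_rank X \<mu>"
    and "uniformly_locally_finite X"
    and "discrete X"
    and "quasigeodesic_space X"
    and "at_most_exponential_growth X"
  shows "property_A X"
proof -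
  \<comment> \<open>The parameters \<open>K\<close> and \<open>H\<close> must be those for which the
    approximating algebras have rank at most \<open>d\<close>, so they come from the finite rank
    hypothesis.\<close>
  obtain d K H where KH: "1 \<le> K" "\<And>n. 0 \<le> H n" "coarse_median_C1 X \<mu> K (H 0)"
    "\<forall>p A. A \<subseteq> X \<and> finite A \<and> 1 \<le> card A \<and> card A \<le> p \<longrightarrow>
      (\<exists>P :: nat set. \<exists>m. median_approximation X \<mu> A (H p) P m \<and> median_rank_le P m d)"
    using assms(2) unfolding coarse_median_finite_rank_def coarse_median_rank_le_def by blast
  obtain G\<^sub>1 G\<^sub>2 where G: "1 \<le> G\<^sub>1" "0 \<le> G\<^sub>2"
    "\<forall>x\<in>X. \<forall>y\<in>X. \<exists>T\<ge>0. \<exists>g. quasigeodesic_path X G\<^sub>1 G\<^sub>2 T g \<and> g 0 = x \<and> g T = y"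
    using assms(5) unfolding quasigeodesic_space_def by blast
  obtain c c' where c: "1 \<le> c" "1 \<le> c'" and growth: "\<forall>x\<in>X. \<forall>R\<ge>0.
      finite (X \<inter> cball x R) \<and> real (card (X \<inter> cball x R)) \<le> c' * c powr R"
    using assms(6) unfolding at_most_exponential_growth_def by blast
  have closed: "\<forall>a\<in>X. \<forall>b\<in>X. \<forall>c\<in>X. \<mu> a b c \<in> X"
    using assms(1) by (simp add: coarse_median_space_def)
  interpret quasigeodesic_coarse_median X \<mu> K H d G\<^sub>1 G\<^sub>2
    using KH G closed by unfold_locales auto
  show ?thesis
    using subexponential_fibres[OF c] growth
    by (intro property_A_if_subexponential_fibres) blast
qed

end
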